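(* Let $(V,Q)$ have signature $(n,2)$ with $n\ge1$ and let $\mathbb D$ be the period domain of Hodge structures of weight $2$ and type $(1,n,1)$ on $V$ polarized by $Q$. For any $r\ge1$ and any $v_1,\dots,v_r\in V_{\mathbb R}$, we have $$\varphi(v_1,\dots,v_r)^*[2r]=\varphi_{KM}(v_1,\dots,v_r),$$ where $\varphi(v_1,\dots,v_r)$ is the form defined from the superconnections $\nabla_{v_i}$ in the context, $\alpha[k]$ denotes the component of degree $k$ of a form $\alpha$, the operator $^*$ acts on $A^{p,p}(\mathbb D)$ by multiplication by $(-2\pi i)^{-p}$, and $\varphi_{KM}$ is the Kudla--Millson form.
   Context: $V$ is a $\mathbb Q$-vector space of dimension $n+2$ with a non-degenerate symmetric bilinear form $Q$ of signature $(n,2)$; $V_{\mathbb R},V_{\mathbb C}$ denote scalar extensions. $\mathbb D=\{u\in V_{\mathbb C}:Q(u,u)=0,\ Q(u,\overline u)<0\}/\mathbb C^\times$, an open subset of a quadric in $\mathbb P(V_{\mathbb C})$. $\mathcal L\to\mathbb D$ is the tautological line bundle (the line $\mathcal L_z\subset V_{\mathbb C}$ is the line represented by $z$), with hermitian metric $(u,u')=-\tfrac12Q(u,\overline{u'})$ and Chern connection $\nabla_{\mathcal L}$. For $v\in V_{\mathbb R}$ let $s_v:\mathcal L\to\mathcal O_{\mathbb D}$, $s_v(u)=Q(u,v)$; $\mathcal O_{\mathbb D}$ carries the standard metric and $s_v^*:\mathcal O_{\mathbb D}\to\mathcal L$ is the adjoint. Then $s_vs_v^*=h_z(s_v)=-Q(v_z,v_z)$,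 where $v_z$ is the orthogonal projection of $v$ to the negative definite plane $(\mathcal L_z\oplus\overline{\mathcal L_z})\cap V_{\mathbb R}$. **The form $\varphi$.** $\mathcal O_{\mathbb D}\oplus\mathcal L$ is a super vector bundle with even part $\mathcal O_{\mathbb D}$ and odd part $\mathcal L$, with superconnection $\nabla_v=d+\nabla_{\mathcal L}+i\sqrt{2\pi}(s_v+s_v^* )$; here $\nabla_v^2\in A^*(\mathbb D)\hat\otimes\Gamma(\mathrm{End}(\mathcal O_{\mathbb D}\oplus\mathcal L))$ (graded tensor product with Koszul sign rule). Put $\varphi(v)=e^{-\pi Q(v,v)}tr_s(e^{\nabla_v^2})\in\oplus_{p\ge0}A^{p,p}(\mathbb D)$ ($tr_s$ is the supertrace: trace on the even part minus trace on the odd part) and $\varphi(v_1,\dots,v_r)=\varphi(v_1)\wedge\cdots\wedge\varphi(v_r)$ (equivalently, $e^{-\pi\sum_iQ(v_i,v_i)}$ times the Chern form of the superconnection $\nabla_{v_1,\dots,v_r}$ induced on the total tensor product of the complexes $s_{v_i}:\mathcal L\to\mathcal O_{\mathbb D}$). **The Kudla--Millson form.** Fix $z\in\mathbb D$ and choose a basis $e_1,\dots,e_{n+2}$ of $V_{\mathbb R}$, orthogonal for $Q$, with $Q(e_\alpha,e_\alpha)=1$ for $1\le\alpha\le n$, $Q(e_\mu,e_\mu)=-1$ for $\mu=n+1,n+2$, and $e_{n+1}+ie_{n+2}\in\mathcal L_z$; let $x_1,\dots,x_{n+2}$ be the coordinates on $V_{\mathbb R}$. The negative planes of points of $\mathbb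 D$ near $z$ are spanned by $e_\mu+\sum_\alpha\xi_{\alpha\mu}e_\alpha$ ($\mu=n+1,n+2$), and $(\xi_{\alpha\mu})$ are real coordinates of $\mathbb D$ near $z$; let $\omega_{\alpha\mu}=d\xi_{\alpha\mu}|_z\in T_z^*\mathbb D$. Then at $z$ $$\varphi_{KM}(v)_z=\tfrac12\prod_{\mu=n+1}^{n+2}\Bigl[\sum_{\alpha=1}^n\Bigl(x_\alpha-\tfrac1{2\pi}\tfrac{\partial}{\partial x_\alpha}\Bigr)\otimes(\omega_{\alpha\mu}\wedge\cdot)\Bigr]e^{-\pi\sum_jx_j^2}=\Bigl(2\sum_{\alpha,\beta}x_\alpha x_\beta\,\omega_{\alpha,n+1}\wedge\omega_{\beta,n+2}-\tfrac1{2\pi}\sum_\alpha\omega_{\alpha,n+1}\wedge\omega_{\alpha,n+2}\Bigr)e^{-\pi\sum_{j=1}^{n+2}x_j^2},$$ with $x_j=x_j(v)$; this is independent of the choice of basis and defines $\varphi_{KM}(v)\in A^{1,1}(\mathbb D)$. Put $\varphi_{KM}(v_1,\dots,v_r)=\varphi_{KM}(v_1)\wedge\cdots\wedge\varphi_{KM}(v_r)$. *)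

theory Defs
  imports "HOL-Analysis.Analysis"
begin

section \<open>The quadratic space and its scalar extensions\<close>

text \<open>
  The rational vector space \<open>V\<close> is \<open>rat ^ 'd\<close> with an arbitrary bilinear form \<open>Q\<close>; its scalar
  extensions are \<open>real ^ 'd\<close> and \<open>complex ^ 'd\<close>.
\<close>

definition sym_bilinear :: "(rat ^ 'd \<Rightarrow> rat ^ 'd \<Rightarrow> rat) \<Rightarrow> bool" where
  "sym_bilinear Q \<longleftrightarrow>
     (\<forall>x. Vector_Spaces.linear (*s) (*) (Q x)) \<and> (\<forall>x y. Q x y = Q y x)"

definition nondegenerate :: "(rat ^ 'd \<Rightarrow> rat ^ 'd \<Rightarrow> rat) \<Rightarrow> bool" where
  "nondegenerate Q \<longleftrightarrow> (\<forall>x. (\<forall>y. Q x y = 0) \<longrightarrow> x = 0)"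

text \<open>The \<open>K\<close>-bilinear extension of \<open>Q\<close>, used for \<open>K = \<real>\<close> and \<open>K = \<complex>\<close>.\<close>

definition ext :: "(rat ^ 'd \<Rightarrow> rat ^ 'd \<Rightarrow> rat) \<Rightarrow> 'k::field_char_0 ^ 'd \<Rightarrow> 'k ^ 'd \<Rightarrow> 'k" where
  "ext Q x y = (\<Sum>i\<in>UNIV. \<Sum>j\<in>UNIV. x $ i * y $ j * of_rat (Q (axis i 1) (axis j 1)))"

definition orthogonal_basis ::
    "(rat ^ 'd \<Rightarrow> rat ^ 'd \<Rightarrow> rat) \<Rightarrow> nat \<Rightarrow> (nat \<Rightarrow> real ^ 'd) \<Rightarrow> bool" where
  "orthogonal_basis Q n e \<longleftrightarrow>
     inj_on e {1..n+2} \<and> independent (e ` {1..n+2}) \<and> span (e ` {1..n+2}) = UNIV \<and>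
     (\<forall>i\<in>{1..n+2}. \<forall>j\<in>{1..n+2}. i \<noteq> j \<longrightarrow> ext Q (e i) (e j) = 0) \<and>
     (\<forall>\<alpha>\<in>{1..n}. ext Q (e \<alpha>) (e \<alpha>) = 1) \<and>
     (\<forall>\<mu>\<in>{n+1..n+2}. ext Q (e \<mu>) (e \<mu>) = -1)"

definition has_signature_n_2 :: "(rat ^ 'd \<Rightarrow> rat ^ 'd \<Rightarrow> rat) \<Rightarrow> nat \<Rightarrow> bool" where
  "has_signature_n_2 Q n \<longleftrightarrow> (\<exists>e. orthogonal_basis Q n e)"

definition complexify :: "real ^ 'd \<Rightarrow> complex ^ 'd" where
  "complexify x = (\<chi> i. complex_of_real (x $ i))"

definition conjv :: "complex ^ 'd \<Rightarrow> complex ^ 'd" where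
  "conjv u = (\<chi> i. cnj (u $ i))"


section \<open>The period domain and the tautological line bundle\<close>

definition cline :: "complex ^ 'd \<Rightarrow> (complex ^ 'd) set" where
  "cline u = range (\<lambda>c. c *s u)"

text \<open>
  A point of \<open>\<D>\<close> is a line in \<open>V\<^sub>\<complex>\<close>, so the fibre \<open>L\<^sub>z\<close> of the tautological bundle is \<open>z\<close> itself.
  For symmetric \<open>Q\<close> the number \<open>Q(u, u\<^sup>-)\<close> is real.
\<close>

definition period_domain :: "(rat ^ 'd \<Rightarrow> rat ^ 'd \<Rightarrow> rat) \<Rightarrow> (complex ^ 'd) set set" where
  "period_domain Q = {cline u | u. ext Q u u = 0 \<and> Re (ext Q u (conjv u)) < 0}"

definition herm :: "(rat ^ 'd \<Rightarrow> rat ^ 'd \<Rightarrow> rat) \<Rightarrow> complex ^ 'd \<Rightarrow> complex ^ 'd \<Rightarrow> complex" where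
  "herm Q u u' = - (1/2) * ext Q u (conjv u')"

definition s_map :: "(rat ^ 'd \<Rightarrow> rat ^ 'd \<Rightarrow> rat) \<Rightarrow> real ^ 'd \<Rightarrow> complex ^ 'd \<Rightarrow> complex" where
  "s_map Q v u = ext Q u (complexify v)"

text \<open>The adjoint of \<open>s\<^sub>v : L\<^sub>z \<rightarrow> \<complex>\<close>, with \<open>(a, b) = a b\<^sup>-\<close> on \<open>\<complex>\<close>.\<close>

definition s_adj ::
    "(rat ^ 'd \<Rightarrow> rat ^ 'd \<Rightarrow> rat) \<Rightarrow> real ^ 'd \<Rightarrow> (complex ^ 'd) set \<Rightarrow> complex \<Rightarrow> complex ^ 'd" where
  "s_adj Q v z a = (THE u. u \<in> z \<and> (\<forall>u'\<in>z. s_map Q v u' * cnj a = herm Q u' u))"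

text \<open>The real plane \<open>(L\<^sub>z \<oplus> conjugate of L\<^sub>z) \<inter> V\<^sub>\<real>\<close>.\<close>

definition neg_plane :: "(complex ^ 'd) set \<Rightarrow> (real ^ 'd) set" where
  "neg_plane z = {x. \<exists>a\<in>z. \<exists>b\<in>z. complexify x = a + conjv b}"


section \<open>Holomorphic charts with a holomorphic frame of the tautological bundle\<close>

fun Ck_on :: "nat \<Rightarrow> 'a::real_normed_vector set \<Rightarrow> ('a \<Rightarrow> 'b::real_normed_vector) \<Rightarrow> bool" where
  "Ck_on 0 U f \<longleftrightarrow> continuous_on U f"
| "Ck_on (Suc k) U f \<longleftrightarrow>
     f differentiable_on U \<and> (\<forall>t. Ck_on k U (\<lambda>w. frechet_derivative f (at w) t))"

text \<open>Holomorphic maps: smooth maps whose differential is complex linear.\<close>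

definition holomorphic_map :: "(complex ^ 'n) set \<Rightarrow> (complex ^ 'n \<Rightarrow> complex ^ 'd) \<Rightarrow> bool" where
  "holomorphic_map U \<sigma> \<longleftrightarrow>
     (\<forall>k. Ck_on k U \<sigma>) \<and>
     (\<forall>w\<in>U. Vector_Spaces.linear (*s) (*s) (frechet_derivative \<sigma> (at w)))"

text \<open>
  A framed chart encodes simultaneously a holomorphic parametrisation \<open>w \<mapsto> [\<sigma> w]\<close> of a subset
  of \<open>\<D>\<close> and the holomorphic frame \<open>\<sigma>\<close> of the tautological bundle over it. The kernel of the
  projection from \<open>V\<^sub>\<complex>\<close> to the tangent space of projective space at \<open>[\<sigma> w]\<close> is the line \<open>[\<sigma> w]\<close>,
  so the last condition says that the parametrisation is an immersion. When \<open>'d\<close> has two more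
  elements than \<open>'n\<close>, both sides have dimension \<open>n\<close>, and an injective immersion is
  a biholomorphism onto an open subset of \<open>\<D>\<close>. Differential forms on \<open>\<D>\<close> are
  described by their expressions in all such charts.
\<close>

definition framed_chart ::
    "(rat ^ 'd \<Rightarrow> rat ^ 'd \<Rightarrow> rat) \<Rightarrow> (complex ^ 'n) set \<Rightarrow> (complex ^ 'n \<Rightarrow> complex ^ 'd) \<Rightarrow> bool" where
  "framed_chart Q U \<sigma> \<longleftrightarrow>
     open U \<and> holomorphic_map U \<sigma> \<and>
     (\<forall>w\<in>U. \<sigma> w \<noteq> 0 \<and> cline (\<sigma> w) \<in> period_domain Q) \<and>
     inj_on (\<lambda>w. cline (\<sigma> w)) U \<and>
     (\<forall>w\<in>U. \<forall>t. frechet_derivative \<sigma> (at w) t \<in> cline (\<sigma> w) \<longrightarrow> t = 0)"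


section \<open>Complex valued differential forms on an open subset of a real vector space\<close>

text \<open>
  A mixed-degree alternating form at a point is given by its values on lists of tangent vectors;
  the degree \<open>k\<close> component is the restriction to lists of length \<open>k\<close>. The wedge product is
  the sum over shuffles, so that \<open>(dx \<and> dy)(\<partial>\<^sub>x, \<partial>\<^sub>y) = 1\<close>.
\<close>

type_synonym 't form = "'t list \<Rightarrow> complex"

definition deg_part :: "nat \<Rightarrow> 't form \<Rightarrow> 't form" where
  "deg_part k \<alpha> = (\<lambda>ts. if length ts = k then \<alpha> ts else 0)"

definition zero_form :: "complex \<Rightarrow> 't form" where
  "zero_form c = (\<lambda>ts. if ts = [] then c else 0)"

definition one_form :: "('t \<Rightarrow> complex) \<Rightarrow> 't form" where
  "one_form f = (\<lambda>ts. case ts of [t] \<Rightarrow> f t | _ \<Rightarrow> 0)"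

definition shuffle_sign :: "nat \<Rightarrow> nat set \<Rightarrow> complex" where
  "shuffle_sign k I = (-1) ^ card {(i, j). i \<in> I \<and> j \<in> {..<k} - I \<and> j < i}"

definition wedge :: "'t form \<Rightarrow> 't form \<Rightarrow> 't form" where
  "wedge \<alpha> \<beta> = (\<lambda>ts. \<Sum>I\<in>Pow {..<length ts}.
     shuffle_sign (length ts) I * \<alpha> (nths ts I) * \<beta> (nths ts ({..<length ts} - I)))"

definition wedge_list :: "'t form list \<Rightarrow> 't form" where
  "wedge_list \<alpha>s = foldr wedge \<alpha>s (zero_form 1)"

text \<open>The exterior derivative of a form on (an open subset of) \<open>'t\<close>, evaluated on constant vector fields.\<close>

definition ext_deriv :: "('t::real_normed_vector \<Rightarrow> 't form) \<Rightarrow> 't \<Rightarrow> 't form" where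
  "ext_deriv A w = (\<lambda>ts. \<Sum>i<length ts. (-1) ^ i *
     frechet_derivative (\<lambda>w'. A w' (take i ts @ drop (Suc i) ts)) (at w) (ts ! i))"

text \<open>\<open>\<alpha> \<mapsto> (-1)\<^sup>p \<alpha>\<close> in degree \<open>p\<close>.\<close>

definition parity :: "'t form \<Rightarrow> 't form" where
  "parity \<alpha> = (\<lambda>ts. (-1) ^ length ts * \<alpha> ts)"

text \<open>
  Multiplication by \<open>(-2\<pi>i)\<^sup>-\<^sup>p\<close> on forms of type \<open>(p,p)\<close>. It is only meaningful on sums of
  such forms, where the degree \<open>2p\<close> component is the component of type \<open>(p,p)\<close>.
\<close>

definition star_op :: "'t form \<Rightarrow> 't form" where
  "star_op \<alpha> = (\<lambda>ts. inverse (- 2 * of_real pi * \<i>) ^ (length ts div 2) * \<alpha> ts)"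


section \<open>The superconnection\<close>

text \<open>
  With respect to the frame \<open>(1, \<sigma>)\<close>, a form with values in the direct sum of the trivial bundle
  and \<open>L\<close> is given by two components and a form with values in its endomorphisms
  by a \<open>2 \<times> 2\<close> matrix of forms. The index \<open>False\<close> is the even (trivial) summand, \<open>True\<close> is the
  odd summand \<open>L\<close>; the \<open>(i, j)\<close> entry maps component \<open>j\<close> to component \<open>i\<close>, and is an odd
  endomorphism iff \<open>i \<noteq> j\<close>.
\<close>

type_synonym 't vform = "bool \<Rightarrow> 't form"
type_synonym 't eform = "bool \<Rightarrow> bool \<Rightarrow> 't form"

text \<open>Product of the graded tensor product: \<open>(\<alpha> \<otimes> a)(\<beta> \<otimes> b) = (-1)\<^sup>|\<^sup>a\<^sup>|\<^sup>|\<^sup>\<beta>\<^sup>| \<alpha>\<beta> \<otimes> ab\<close>.\<close>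

definition emult :: "'t eform \<Rightarrow> 't eform \<Rightarrow> 't eform" where
  "emult M N = (\<lambda>i k ts. \<Sum>j\<in>UNIV.
     wedge (M i j) (if i \<noteq> j then parity (N j k) else N j k) ts)"

definition eone :: "'t eform" where
  "eone = (\<lambda>i j. if i = j then zero_form 1 else zero_form 0)"

primrec epow :: "'t eform \<Rightarrow> nat \<Rightarrow> 't eform" where
  "epow M 0 = eone"
| "epow M (Suc k) = emult M (epow M k)"

definition eexp :: "'t eform \<Rightarrow> 't eform" where
  "eexp M = (\<lambda>i j ts. \<Sum>k. epow M k i j ts / fact k)"

definition supertrace :: "'t eform \<Rightarrow> 't form" where
  "supertrace M = (\<lambda>ts. M False False ts - M True True ts)"

text \<open>
  The Chern connection of \<open>L\<close> is the unique connection that has \<open>(0,1)\<close>-part the Cauchy-Riemann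
  operator and is compatible with the metric. If \<open>\<theta>\<close> denotes its connection form in the frame \<open>\<sigma>\<close>,
  so that \<open>\<nabla>\<sigma> = \<theta> \<otimes> \<sigma>\<close>, then the first condition says that \<open>\<theta>\<close> is of type \<open>(1,0)\<close>
  and the second one that \<open>d(\<sigma>,\<sigma>) = (\<nabla>\<sigma>,\<sigma>) + (\<sigma>,\<nabla>\<sigma>)\<close>.
\<close>

definition chern_form ::
    "(rat ^ 'd \<Rightarrow> rat ^ 'd \<Rightarrow> rat) \<Rightarrow> (complex ^ 'n \<Rightarrow> complex ^ 'd) \<Rightarrow> complex ^ 'n \<Rightarrow> complex ^ 'n \<Rightarrow> complex"
  where
  "chern_form Q \<sigma> w = (THE \<theta>.
     Vector_Spaces.linear (*s) (*) \<theta> \<and>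
     (\<forall>t. frechet_derivative (\<lambda>w'. herm Q (\<sigma> w') (\<sigma> w')) (at w) t =
          herm Q (\<theta> t *s \<sigma> w) (\<sigma> w) + herm Q (\<sigma> w) (\<theta> t *s \<sigma> w)))"

definition frame_coeff :: "complex ^ 'd \<Rightarrow> complex ^ 'd \<Rightarrow> complex" where
  "frame_coeff f u = (THE c. u = c *s f)"

text \<open>
  The operator \<open>d + \<nabla>\<^sub>L + i\<surd>(2\<pi>)(s\<^sub>v + s\<^sub>v\<^sup>*)\<close>. Here \<open>\<nabla>\<^sub>L(\<beta> \<otimes> \<sigma>) = d\<beta> \<otimes> \<sigma> + (-1)\<^sup>|\<^sup>\<beta>\<^sup>| \<beta> \<and> \<nabla>\<^sub>L\<sigma>\<close>, and an odd
  endomorphism \<open>a\<close> acts by \<open>a(\<beta> \<otimes> x) = (-1)\<^sup>|\<^sup>\<beta>\<^sup>| \<beta> \<otimes> a(x)\<close>.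
\<close>

definition superconn ::
    "(rat ^ 'd \<Rightarrow> rat ^ 'd \<Rightarrow> rat) \<Rightarrow> (complex ^ 'n \<Rightarrow> complex ^ 'd) \<Rightarrow> real ^ 'd \<Rightarrow>
     (complex ^ 'n \<Rightarrow> (complex ^ 'n) vform) \<Rightarrow> complex ^ 'n \<Rightarrow> (complex ^ 'n) vform" where
  "superconn Q \<sigma> v \<psi> w = (\<lambda>i ts.
     if \<not> i then
       ext_deriv (\<lambda>w'. \<psi> w' False) w ts
       + \<i> * of_real (sqrt (2 * pi)) * (s_map Q v (\<sigma> w) * parity (\<psi> w True) ts)
     else
       ext_deriv (\<lambda>w'. \<psi> w' True) w ts
       + wedge (parity (\<psi> w True)) (one_form (chern_form Q \<sigma> w)) ts
       + \<i> * of_real (sqrt (2 * pi)) *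
           (frame_coeff (\<sigma> w) (s_adj Q v (cline (\<sigma> w)) 1) * parity (\<psi> w False) ts))"

text \<open>
  \<open>\<nabla>\<^sub>v\<^sup>2\<close> is linear over differential forms; column \<open>j\<close> of its matrix is the image of the
  \<open>j\<close>-th element of the frame \<open>(1, \<sigma>)\<close>.
\<close>

definition frame_section :: "bool \<Rightarrow> complex ^ 'n \<Rightarrow> (complex ^ 'n) vform" where
  "frame_section j w = (\<lambda>i. eone i j)"

definition curvature ::
    "(rat ^ 'd \<Rightarrow> rat ^ 'd \<Rightarrow> rat) \<Rightarrow> (complex ^ 'n \<Rightarrow> complex ^ 'd) \<Rightarrow> real ^ 'd \<Rightarrow>
     complex ^ 'n \<Rightarrow> (complex ^ 'n) eform" where
  "curvature Q \<sigma> v w = (\<lambda>i j. superconn Q \<sigma> v (superconn Q \<sigma> v (frame_section j)) w i)"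

definition phi ::
    "(rat ^ 'd \<Rightarrow> rat ^ 'd \<Rightarrow> rat) \<Rightarrow> (complex ^ 'n \<Rightarrow> complex ^ 'd) \<Rightarrow> real ^ 'd \<Rightarrow>
     complex ^ 'n \<Rightarrow> (complex ^ 'n) form" where
  "phi Q \<sigma> v w = (\<lambda>ts.
     of_real (exp (- pi * ext Q v v)) * supertrace (eexp (curvature Q \<sigma> v w)) ts)"

definition phi_tuple ::
    "(rat ^ 'd \<Rightarrow> rat ^ 'd \<Rightarrow> rat) \<Rightarrow> (complex ^ 'n \<Rightarrow> complex ^ 'd) \<Rightarrow> (real ^ 'd) list \<Rightarrow>
     complex ^ 'n \<Rightarrow> (complex ^ 'n) form" where
  "phi_tuple Q \<sigma> vs w = wedge_list (map (\<lambda>v. phi Q \<sigma> v w) vs)"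


section \<open>The Kudla-Millson form\<close>

definition adapted_basis ::
    "(rat ^ 'd \<Rightarrow> rat ^ 'd \<Rightarrow> rat) \<Rightarrow> nat \<Rightarrow> (complex ^ 'd) set \<Rightarrow> (nat \<Rightarrow> real ^ 'd) \<Rightarrow> bool" where
  "adapted_basis Q n z e \<longleftrightarrow>
     orthogonal_basis Q n e \<and> complexify (e (n+1)) + \<i> *s complexify (e (n+2)) \<in> z"

definition basis_coord :: "nat \<Rightarrow> (nat \<Rightarrow> real ^ 'd) \<Rightarrow> nat \<Rightarrow> real ^ 'd \<Rightarrow> real" where
  "basis_coord n e j v = representation (e ` {1..n+2}) v (e j)"

text \<open>
  The coordinates \<open>\<xi>\<^bsub>\<alpha>\<mu>\<^esub>\<close> of a point of \<open>\<D>\<close>: its negative plane is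
  spanned by the vectors \<open>e\<^sub>\<mu> + \<Sum>\<^sub>\<alpha> \<xi>\<^bsub>\<alpha>\<mu>\<^esub> e\<^sub>\<alpha>\<close>, \<open>\<mu> = n+1, n+2\<close>.
\<close>

definition xi_coord ::
    "nat \<Rightarrow> (nat \<Rightarrow> real ^ 'd) \<Rightarrow> nat \<Rightarrow> nat \<Rightarrow> (complex ^ 'd) set \<Rightarrow> real" where
  "xi_coord n e \<alpha> \<mu> z = (THE \<xi>. (\<forall>\<beta>. \<beta> \<notin> {1..n} \<longrightarrow> \<xi> \<beta> = 0) \<and>
     e \<mu> + (\<Sum>\<beta>=1..n. \<xi> \<beta> *\<^sub>R e \<beta>) \<in> neg_plane z) \<alpha>"

definition omega ::
    "(nat \<Rightarrow> real ^ 'd) \<Rightarrow> (complex ^ 'n \<Rightarrow> complex ^ 'd) \<Rightarrow> complex ^ 'n \<Rightarrow> nat \<Rightarrow> nat \<Rightarrow>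
     (complex ^ 'n) form" where
  "omega e \<sigma> w \<alpha> \<mu> = one_form (\<lambda>t. of_real
     (frechet_derivative (\<lambda>w'. xi_coord CARD('n) e \<alpha> \<mu> (cline (\<sigma> w'))) (at w) t))"

text \<open>
  The operator \<open>\<Sum>\<^sub>\<alpha> (x\<^sub>\<alpha> - (1/2\<pi>) \<partial>/\<partial>x\<^sub>\<alpha>) \<otimes> (\<omega>\<^bsub>\<alpha>\<mu>\<^esub> \<and> \<cdot>)\<close> on functions on \<open>V\<^sub>\<real>\<close> with values in forms
  at a fixed point; \<open>\<partial>/\<partial>x\<^sub>\<alpha>\<close> is the derivative in the direction \<open>e\<^sub>\<alpha>\<close>.
\<close>

definition howe_op ::
    "(nat \<Rightarrow> real ^ 'd) \<Rightarrow> (complex ^ 'n \<Rightarrow> complex ^ 'd) \<Rightarrow> complex ^ 'n \<Rightarrow> nat \<Rightarrow>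
     (real ^ 'd \<Rightarrow> (complex ^ 'n) form) \<Rightarrow> real ^ 'd \<Rightarrow> (complex ^ 'n) form" where
  "howe_op e \<sigma> w \<mu> F v = (\<lambda>ts. \<Sum>\<alpha>=1..CARD('n). wedge (omega e \<sigma> w \<alpha> \<mu>)
     (\<lambda>ts'. of_real (basis_coord CARD('n) e \<alpha> v) * F v ts'
        - of_real (1 / (2 * pi)) * frechet_derivative (\<lambda>v'. F v' ts') (at v) (e \<alpha>)) ts)"

definition gaussian :: "nat \<Rightarrow> (nat \<Rightarrow> real ^ 'd) \<Rightarrow> real ^ 'd \<Rightarrow> real" where
  "gaussian n e v = exp (- pi * (\<Sum>j=1..n+2. (basis_coord n e j v)\<^sup>2))"

definition phi_KM_basis ::
    "(nat \<Rightarrow> real ^ 'd) \<Rightarrow> (complex ^ 'n \<Rightarrow> complex ^ 'd) \<Rightarrow> complex ^ 'n \<Rightarrow> real ^ 'd \<Rightarrow>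
     (complex ^ 'n) form" where
  "phi_KM_basis e \<sigma> w v = (\<lambda>ts. 1/2 *
     howe_op e \<sigma> w (CARD('n) + 1) (howe_op e \<sigma> w (CARD('n) + 2)
       (\<lambda>v'. zero_form (of_real (gaussian CARD('n) e v')))) v ts)"

text \<open>The common value of the preceding expression for all adapted bases at \<open>[\<sigma> w]\<close>.\<close>

definition phi_KM ::
    "(rat ^ 'd \<Rightarrow> rat ^ 'd \<Rightarrow> rat) \<Rightarrow> (complex ^ 'n \<Rightarrow> complex ^ 'd) \<Rightarrow> real ^ 'd \<Rightarrow>
     complex ^ 'n \<Rightarrow> (complex ^ 'n) form" where
  "phi_KM Q \<sigma> v w = (THE \<alpha>. \<exists>e. adapted_basis Q CARD('n) (cline (\<sigma> w)) e \<and>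
     \<alpha> = phi_KM_basis e \<sigma> w v)"

definition phi_KM_tuple ::
    "(rat ^ 'd \<Rightarrow> rat ^ 'd \<Rightarrow> rat) \<Rightarrow> (complex ^ 'n \<Rightarrow> complex ^ 'd) \<Rightarrow> (real ^ 'd) list \<Rightarrow>
     complex ^ 'n \<Rightarrow> (complex ^ 'n) form" where
  "phi_KM_tuple Q \<sigma> vs w = wedge_list (map (\<lambda>v. phi_KM Q \<sigma> v w) vs)"

end

theory Submission
  imports Defs
begin

text \<open>
  The component of degree 0 of \<open>\<phi>(v)\<close> is a supertrace of a multiple of the identity, hence 0, and
  that of degree 1 is 0 by parity; so the degree \<open>2r\<close> component of the wedge product is the
  product of the degree 2 components and only \<open>r = 1\<close> has to be treated. In the frame \<open>(1, \<sigma>)\<close>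
  the curvature is the central scalar \<open>-2\<pi> h(s\<^sub>v)\<close> plus the matrix with entries
  \<open>\<kappa> \<nabla>s\<^sub>v\<close>, \<open>\<kappa> \<nabla>s\<^sub>v\<^sup>*\<close> off the diagonal and the curvature of \<open>L\<close> in the lower corner
  (\<open>\<kappa> = i\<surd>(2\<pi>)\<close>), and the degree 2 part of the supertrace of its exponential is explicit.
  If \<open>e\<^bsub>n+1\<^esub> + i e\<^bsub>n+2\<^esub> = c \<sigma>(w)\<close>, then \<open>c Q(d\<sigma>, e\<^sub>\<alpha>) = \<omega>\<^bsub>\<alpha>,n+1\<^esub> + i \<omega>\<^bsub>\<alpha>,n+2\<^esub>\<close>,
  because the components of \<open>d\<sigma>\<close> along the negative plane only rescale and rotate the frame; both forms
  become the same polynomial in these numbers. As this holds for every adapted basis, the Kudla-Millson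
  form does not depend on the basis; existence of an adapted basis is Sylvester's law of inertia.
\<close>

section \<open>Wedge products on short lists, and the lowest-degree term of a product\<close>

section \<open>Wedge products\<close>

lemma wedge_Nil: "wedge \<alpha> \<beta> [] = \<alpha> [] * \<beta> []"
  by (simp add: wedge_def shuffle_sign_def)

lemma Pow_lessThan_1: "Pow {..<Suc 0} = {{}, {0::nat}}"
  by (auto simp: lessThan_Suc)

lemma Pow_lessThan_2: "Pow {..<Suc (Suc 0)} = {{}, {0::nat}, {1}, {0, 1}}"
  by (auto simp: lessThan_Suc)

lemma wedge_single: "wedge \<alpha> \<beta> [t] = \<alpha> [] * \<beta> [t] + \<alpha> [t] * \<beta> []"
proof -
  have "nths [t] {..<Suc 0} = [t]" by (simp add: nths_Cons)
  then show ?thesis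
    by (simp add: wedge_def shuffle_sign_def Pow_lessThan_1 nths_Cons conj_commute cong: conj_cong)
qed

lemma shuffle_sign_pair:
  "shuffle_sign (Suc (Suc 0)) {} = 1" "shuffle_sign (Suc (Suc 0)) {0} = 1"
  "shuffle_sign (Suc (Suc 0)) {Suc 0} = -1" "shuffle_sign (Suc (Suc 0)) {0, Suc 0} = 1"
proof -
  have *: "{(i, j). i \<in> {0::nat} \<and> j \<in> {..<Suc (Suc 0)} - {0} \<and> j < i} = {}"
    "{(i, j). i \<in> {Suc 0} \<and> j \<in> {..<Suc (Suc 0)} - {Suc 0} \<and> j < i} = {(Suc 0, 0)}"
    "{(i, j). i \<in> {0, Suc 0} \<and> j \<in> {..<Suc (Suc 0)} - {0, Suc 0} \<and> j < i} = {}"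
    by auto
  show "shuffle_sign (Suc (Suc 0)) {} = 1" "shuffle_sign (Suc (Suc 0)) {0} = 1"
    "shuffle_sign (Suc (Suc 0)) {Suc 0} = -1" "shuffle_sign (Suc (Suc 0)) {0, Suc 0} = 1"
    unfolding shuffle_sign_def * by simp_all
qed

lemma wedge_pair:
  "wedge \<alpha> \<beta> [t, u] = \<alpha> [] * \<beta> [t, u] + \<alpha> [t] * \<beta> [u] - \<alpha> [u] * \<beta> [t] + \<alpha> [t, u] * \<beta> []"
proof -
  have c: "{..<Suc (Suc 0)} - {} = {0, Suc 0}" "{..<Suc (Suc 0)} - {0} = {Suc 0}"
    "{..<Suc (Suc 0)} - {Suc 0} = {0}" "{..<Suc (Suc 0)} - {0, Suc 0} = {}"
    by auto
  have n: "nths [t, u] {} = []" "nths [t, u] {0} = [t]" "nths [t, u] {Suc 0} = [u]"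
    "nths [t, u] {0, Suc 0} = [t, u]"
    by (simp_all add: nths_Cons)
  have d: "{} \<noteq> {0::nat}" "{} \<noteq> {Suc 0}" "{} \<noteq> {0, Suc 0}" "{0} \<noteq> {Suc 0}" "{0} \<noteq> {0, Suc 0}"
    "{Suc 0} \<noteq> {0, Suc 0}" by auto
  have "wedge \<alpha> \<beta> [t, u] = (\<Sum>I\<in>{{}, {0}, {Suc 0}, {0, Suc 0}}.
     shuffle_sign (Suc (Suc 0)) I * \<alpha> (nths [t, u] I) * \<beta> (nths [t, u] ({..<Suc (Suc 0)} - I)))"
    by (simp add: wedge_def Pow_lessThan_2 del: sum.insert)
  also have "\<dots> = \<alpha> [] * \<beta> [t, u] + (\<alpha> [t] * \<beta> [u] + (- \<alpha> [u] * \<beta> [t] + \<alpha> [t, u] * \<beta> []))"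
    using d by (subst sum.insert; simp add: c n shuffle_sign_pair del: Diff_insert Diff_empty sum.insert)+
  finally show ?thesis by simp
qed

text \<open>Only a lower bound on the degree. Components of \<phi>(v) above degree 2 may exist, but
  cannot contribute to degree 2r of the product, the other factors having nothing below degree
  2.\<close>

definition vanishes_below :: "nat \<Rightarrow> 't form \<Rightarrow> bool" where
  "vanishes_below p \<alpha> \<longleftrightarrow> (\<forall>ts. length ts < p \<longrightarrow> \<alpha> ts = 0)"

lemma length_nths_subset: "I \<subseteq> {..<length ts} \<Longrightarrow> length (nths ts I) = card I"
  by (simp add: length_nths) (metis Collect_mem_eq inf.absorb2 Collect_conj_eq lessThan_def inf_commute)

lemma length_nths_compl:
  assumes "I \<subseteq> {..<length ts}"
  shows "length (nths ts ({..<length ts} - I)) = length ts - card I" "card I \<le> length ts"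
  using assms length_nths_subset[of "{..<length ts} - I" ts]
  by (simp_all add: card_Diff_subset finite_subset subset_eq_atLeast0_lessThan_card lessThan_atLeast0)

text \<open>A shuffle cuts a list of length less than \<open>p + q\<close> into two pieces, one of
  which is too short for its factor.\<close>

lemma vanishes_below_wedge:
  assumes "vanishes_below p \<alpha>" "vanishes_below q \<beta>"
  shows "vanishes_below (p + q) (wedge \<alpha> \<beta>)"
  unfolding vanishes_below_def
proof (intro allI impI)
  fix ts :: "'a list" assume l: "length ts < p + q"
  show "wedge \<alpha> \<beta> ts = 0"
    unfolding wedge_def
  proof (intro sum.neutral ballI)
    fix I assume "I \<in> Pow {..<length ts}"
    then have I: "I \<subseteq> {..<length ts}" by simp
    have "card I < p \<or> length ts - card I < q" using l length_nths_compl(2)[OF I] by arith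
    then show "shuffle_sign (length ts) I * \<alpha> (nths ts I) * \<beta> (nths ts ({..<length ts} - I)) = 0"
      using assms length_nths_subset[OF I] length_nths_compl[OF I] by (auto simp: vanishes_below_def)
  qed
qed

text \<open>In degree \<open>2 * (p + q)\<close> only the shuffles with
  \<open>card I = 2 * p\<close> survive, and for them the power of \<open>c\<close> splits as a
  product. Because the degrees are even, the \<open>div 2\<close> in \<open>star_op\<close> is
  additive here.\<close>

lemma star_wedge_lowest:
  assumes "vanishes_below (2 * p) \<alpha>" "vanishes_below (2 * q) \<beta>"
  shows "deg_part (2 * (p + q)) (star_op (wedge \<alpha> \<beta>)) =
    wedge (deg_part (2 * p) (star_op \<alpha>)) (deg_part (2 * q) (star_op \<beta>))"
proof
  fix ts :: "'a list"
  define c :: complex where "c = inverse (- 2 * of_real pi * \<i>)"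
  have star: "star_op \<gamma> us = c ^ (length us div 2) * \<gamma> us" for \<gamma> and us :: "'a list"
    by (simp only: star_op_def c_def)
  \<comment> \<open>Restriction to a degree and the star operator together act as one scalar on the
    value at \<open>ts\<close>, so the identity can be compared shuffle by shuffle.\<close>
  have "(if length ts = 2 * (p + q) then c ^ (length ts div 2) else 0) *
      (shuffle_sign (length ts) I * \<alpha> (nths ts I) * \<beta> (nths ts ({..<length ts} - I))) =
     shuffle_sign (length ts) I * deg_part (2 * p) (star_op \<alpha>) (nths ts I) *
        deg_part (2 * q) (star_op \<beta>) (nths ts ({..<length ts} - I))"
    if "I \<in> Pow {..<length ts}" for I
  proof -
    have I: "I \<subseteq> {..<length ts}" using that by simp
    note L = length_nths_subset[OF I] length_nths_compl[OF I]
    consider "card I < 2 * p" | "length ts - card I < 2 * q"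
      | "card I = 2 * p" "length ts - card I = 2 * q" | "length ts > 2 * (p + q)"
      using L(3) by atomize_elim arith
    then show ?thesis
    proof cases
      case 3
      then have "length ts = 2 * (p + q)" using L(3) by arith
      then show ?thesis using 3 L
        by (simp add: deg_part_def star power_add)
    next
      case 4
      then have "\<not> (card I = 2 * p \<and> length ts - card I = 2 * q)" using L(3) by arith
      then show ?thesis using 4 L by (auto simp: deg_part_def)
    qed (use assms L in \<open>auto simp: vanishes_below_def deg_part_def star\<close>)
  qed
  then have "(if length ts = 2 * (p + q) then c ^ (length ts div 2) else 0) * wedge \<alpha> \<beta> ts =
    wedge (deg_part (2 * p) (star_op \<alpha>)) (deg_part (2 * q) (star_op \<beta>)) ts"
    unfolding wedge_def sum_distrib_left by (rule sum.cong[OF refl])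
  then show "deg_part (2 * (p + q)) (star_op (wedge \<alpha> \<beta>)) ts =
    wedge (deg_part (2 * p) (star_op \<alpha>)) (deg_part (2 * q) (star_op \<beta>)) ts"
    by (simp add: deg_part_def star split: if_splits)
qed

text \<open>The vanishing statement is carried through the induction because
  \<open>star_wedge_lowest\<close> requires it of the product over the tail.\<close>

lemma star_wedge_list_lowest:
  assumes "\<And>v. v \<in> set vs \<Longrightarrow> vanishes_below 2 (F v)"
  shows "vanishes_below (2 * length vs) (wedge_list (map F vs)) \<and>
    deg_part (2 * length vs) (star_op (wedge_list (map F vs))) =
    wedge_list (map (\<lambda>v. deg_part 2 (star_op (F v))) vs)"
  using assms
proof (induction vs)
  case Nil
  show ?case
    by (auto simp: wedge_list_def deg_part_def star_op_def zero_form_def vanishes_below_def)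
next
  case (Cons v vs)
  then have v: "vanishes_below 2 (F v)"
    and IH: "vanishes_below (2 * length vs) (wedge_list (map F vs))"
    "deg_part (2 * length vs) (star_op (wedge_list (map F vs))) =
      wedge_list (map (\<lambda>v. deg_part 2 (star_op (F v))) vs)" by auto
  have "wedge_list (map F (v # vs)) = wedge (F v) (wedge_list (map F vs))"
    by (simp add: wedge_list_def)
  moreover have "wedge_list (map (\<lambda>v. deg_part 2 (star_op (F v))) (v # vs)) =
     wedge (deg_part 2 (star_op (F v))) (wedge_list (map (\<lambda>v. deg_part 2 (star_op (F v))) vs))"
    by (simp add: wedge_list_def)
  ultimately show ?case
    using vanishes_below_wedge[OF v IH(1)] star_wedge_lowest[of 1 "F v" "length vs"] v IH
    by simp
qed

section \<open>Schwarz's theorem by second differences\<close>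

section \<open>Symmetry of second derivatives\<close>

text \<open>The mean value theorem is used twice: along \<open>t\<close> for the difference \<phi>,
  then along \<open>u\<close> for the derivative \<open>f' _ t\<close>. The bound on
  \<open>h\<close> keeps the whole parallelogram in the ball of radius \<open>e\<close>.\<close>

lemma second_difference_eq:
  fixes f :: "'a::real_normed_vector \<Rightarrow> real"
  assumes "0 < h" "h * (norm t + norm u) < e"
    and f: "\<And>x. dist x w < e \<Longrightarrow> (f has_derivative f' x) (at x)"
    and f'': "\<And>x. dist x w < e \<Longrightarrow> ((\<lambda>x. f' x t) has_derivative F x) (at x)"
  shows "\<exists>p. dist p w < e \<and>
    f (w + h *\<^sub>R t + h *\<^sub>R u) - f (w + h *\<^sub>R t) - f (w + h *\<^sub>R u) + f w = h\<^sup>2 * F p u"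
proof -
  have near: "dist (w + a *\<^sub>R t + b *\<^sub>R u) w < e" if "0 \<le> a" "a \<le> h" "0 \<le> b" "b \<le> h" for a b
  proof -
    have "norm (a *\<^sub>R t + b *\<^sub>R u) \<le> a * norm t + b * norm u"
      using that norm_triangle_ineq[of "a *\<^sub>R t" "b *\<^sub>R u"] by simp
    also have "\<dots> \<le> h * (norm t + norm u)"
      using that by (simp add: distrib_left add_mono mult_right_mono)
    finally show ?thesis using assms by (simp add: dist_norm add.assoc)
  qed
  define \<phi> where "\<phi> a = f (w + a *\<^sub>R t + h *\<^sub>R u) - f (w + a *\<^sub>R t)" for a
  have "\<exists>a>0. a < h \<and> \<phi> h - \<phi> 0 = (h - 0) * (f' (w + a *\<^sub>R t + h *\<^sub>R u) t - f' (w + a *\<^sub>R t) t)"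
  proof (rule MVT2)
    fix a :: real assume a: "0 \<le> a" "a \<le> h"
    have "(f has_derivative f' (w + a *\<^sub>R t + h *\<^sub>R u)) (at (w + a *\<^sub>R t + h *\<^sub>R u))"
      using a near[of a h] assms(1) by (intro f) auto
    from this have 1: "((\<lambda>a. f (w + a *\<^sub>R t + h *\<^sub>R u)) has_derivative (\<lambda>k. f' (w + a *\<^sub>R t + h *\<^sub>R u) (k *\<^sub>R t))) (at a)"
      by (rule has_derivative_compose[rotated]) (auto intro!: derivative_eq_intros)
    have "(f has_derivative f' (w + a *\<^sub>R t)) (at (w + a *\<^sub>R t))"
      using a near[of a 0] assms(1) by (intro f) auto
    from this have 2: "((\<lambda>a. f (w + a *\<^sub>R t)) has_derivative (\<lambda>k. f' (w + a *\<^sub>R t) (k *\<^sub>R t))) (at a)"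
      by (rule has_derivative_compose[rotated]) (auto intro!: derivative_eq_intros)
    have l: "linear (f' (w + a *\<^sub>R t + h *\<^sub>R u))" "linear (f' (w + a *\<^sub>R t))"
      using a near[of a h] near[of a 0] assms(1) f has_derivative_linear by fastforce+
    show "(\<phi> has_real_derivative f' (w + a *\<^sub>R t + h *\<^sub>R u) t - f' (w + a *\<^sub>R t) t) (at a)"
      unfolding \<phi>_def has_field_derivative_def
      by (rule has_derivative_eq_rhs[OF has_derivative_diff[OF 1 2]])
        (auto simp only: linear_cmul[OF l(1)] linear_cmul[OF l(2)] real_scaleR_def right_diff_distrib mult.commute)
  qed (use assms in auto)
  then obtain a where a: "0 < a" "a < h"
    "\<phi> h - \<phi> 0 = h * (f' (w + a *\<^sub>R t + h *\<^sub>R u) t - f' (w + a *\<^sub>R t) t)" by auto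
  have "\<exists>b>0. b < h \<and> f' (w + a *\<^sub>R t + h *\<^sub>R u) t - f' (w + a *\<^sub>R t + 0 *\<^sub>R u) t =
      (h - 0) * F (w + a *\<^sub>R t + b *\<^sub>R u) u"
  proof (rule MVT2)
    fix b :: real assume b: "0 \<le> b" "b \<le> h"
    have D: "((\<lambda>x. f' x t) has_derivative F (w + a *\<^sub>R t + b *\<^sub>R u)) (at (w + a *\<^sub>R t + b *\<^sub>R u))"
      using a b near[of a b] by (intro f'') auto
    then have 1: "((\<lambda>b. f' (w + a *\<^sub>R t + b *\<^sub>R u) t) has_derivative
        (\<lambda>k. F (w + a *\<^sub>R t + b *\<^sub>R u) (k *\<^sub>R u))) (at b)"
      by (rule has_derivative_compose[rotated]) (auto intro!: derivative_eq_intros)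
    show "((\<lambda>b. f' (w + a *\<^sub>R t + b *\<^sub>R u) t) has_real_derivative F (w + a *\<^sub>R t + b *\<^sub>R u) u) (at b)"
      unfolding has_field_derivative_def
      by (rule has_derivative_eq_rhs[OF 1])
        (auto simp: linear_cmul[OF has_derivative_linear[OF D]] mult.commute)
  qed (use assms in auto)
  then obtain b where b: "0 < b" "b < h"
    "f' (w + a *\<^sub>R t + h *\<^sub>R u) t - f' (w + a *\<^sub>R t) t = h * F (w + a *\<^sub>R t + b *\<^sub>R u) u" by auto
  have "\<phi> h - \<phi> 0 = h\<^sup>2 * F (w + a *\<^sub>R t + b *\<^sub>R u) u"
    using a b by (simp add: power2_eq_square)
  then show ?thesis
    using near[of a b] a b by (intro exI[of _ "w + a *\<^sub>R t + b *\<^sub>R u"]) (auto simp: \<phi>_def)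
qed

text \<open>The second difference is symmetric in \<open>t\<close> and \<open>u\<close>, so both
  orders of differentiation give it, at two points near \<open>w\<close>; continuity then transfers
  the equality to \<open>w\<close>.\<close>

lemma second_derivative_symmetric_real:
  fixes f :: "'a::real_normed_vector \<Rightarrow> real"
  assumes "open U" "w \<in> U"
    and f: "\<And>x. x \<in> U \<Longrightarrow> (f has_derivative f' x) (at x)"
    and F: "\<And>x. x \<in> U \<Longrightarrow> ((\<lambda>x. f' x t) has_derivative F x) (at x)"
    and G: "\<And>x. x \<in> U \<Longrightarrow> ((\<lambda>x. f' x u) has_derivative G x) (at x)"
    and cont: "continuous_on U (\<lambda>x. F x u)" "continuous_on U (\<lambda>x. G x t)"
  shows "F w u = G w t"
proof (rule ccontr)
  assume "F w u \<noteq> G w t"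
  \<comment> \<open>Half the gap between the two values: two numbers within \<epsilon> of them
    cannot coincide.\<close>
  define \<epsilon> where "\<epsilon> = dist (F w u) (G w t) / 2"
  have \<epsilon>: "\<epsilon> > 0" using \<open>F w u \<noteq> G w t\<close> by (simp add: \<epsilon>_def)
  have iF: "isCont (\<lambda>x. F x u) w" and iG: "isCont (\<lambda>x. G x t) w"
    using cont assms(1,2) continuous_on_eq_continuous_at by blast+
  obtain d1 where d1: "d1 > 0" "\<And>x. dist x w < d1 \<Longrightarrow> dist (F x u) (F w u) < \<epsilon>"
    using iF \<epsilon> unfolding continuous_at by (metis (no_types, lifting) continuous_at_eps_delta iF)
  obtain d2 where d2: "d2 > 0" "\<And>x. dist x w < d2 \<Longrightarrow> dist (G x t) (G w t) < \<epsilon>"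
    using iG \<epsilon> unfolding continuous_at by (metis (no_types, lifting) continuous_at_eps_delta iG)
  obtain d3 where d3: "d3 > 0" "\<And>x. dist x w < d3 \<Longrightarrow> x \<in> U"
    using assms(1,2) open_dist by blast
  define e where "e = min d1 (min d2 d3)"
  have e: "e > 0" using d1 d2 d3 by (simp add: e_def)
  \<comment> \<open>This gives \<open>h * (norm t + norm u + 1) = e / 2\<close>; the summand 1 keeps
    the denominator positive when both vectors are 0.\<close>
  define h where "h = e / (2 * (norm t + norm u + 1))"
  have pos: "norm t + norm u + 1 > 0" by (simp add: add_nonneg_pos)
  have h: "h > 0" using e pos by (simp add: h_def)
  have "h * (norm t + norm u) \<le> h * (norm t + norm u + 1)" using h by simp
  also have "\<dots> = e / 2" using pos by (simp only: h_def) (simp add: divide_simps del: distrib_left_numeral)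
  finally have he: "h * (norm t + norm u) < e" using e by linarith
  obtain p where p: "dist p w < e"
    "f (w + h *\<^sub>R t + h *\<^sub>R u) - f (w + h *\<^sub>R t) - f (w + h *\<^sub>R u) + f w = h\<^sup>2 * F p u"
    using second_difference_eq[of h t u e w f f' F] h he f F d3(2) by (auto simp: e_def)
  obtain q where q: "dist q w < e"
    "f (w + h *\<^sub>R u + h *\<^sub>R t) - f (w + h *\<^sub>R u) - f (w + h *\<^sub>R t) + f w = h\<^sup>2 * G q t"
    using second_difference_eq[of h u t e w f f' G] h he f G d3(2) by (auto simp: e_def add.commute)
  have "w + h *\<^sub>R u + h *\<^sub>R t = w + h *\<^sub>R t + h *\<^sub>R u" by simp
  from p(2) q(2)[unfolded this] have "h\<^sup>2 * F p u = h\<^sup>2 * G q t" by linarith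
  then have "F p u = G q t" using h by simp
  moreover have "dist (F p u) (F w u) < \<epsilon>" "dist (G q t) (G w t) < \<epsilon>"
    using p q d1 d2 by (auto simp: e_def)
  ultimately show False
    unfolding \<epsilon>_def dist_real_def by (smt (verit) field_sum_of_halves)
qed

text \<open>The mean value theorem concerns real functions, so the vector-valued case is read off
  from the components.\<close>

lemma second_derivative_symmetric:
  fixes f :: "'a::real_normed_vector \<Rightarrow> 'b::euclidean_space"
  assumes "open U" "w \<in> U"
    and f: "\<And>x. x \<in> U \<Longrightarrow> (f has_derivative f' x) (at x)"
    and F: "\<And>x. x \<in> U \<Longrightarrow> ((\<lambda>x. f' x t) has_derivative F x) (at x)"
    and G: "\<And>x. x \<in> U \<Longrightarrow> ((\<lambda>x. f' x u) has_derivative G x) (at x)"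
    and cont: "continuous_on U (\<lambda>x. F x u)" "continuous_on U (\<lambda>x. G x t)"
  shows "F w u = G w t"
proof (rule euclidean_eqI)
  fix b :: 'b assume "b \<in> Basis"
  show "F w u \<bullet> b = G w t \<bullet> b"
    by (rule second_derivative_symmetric_real[OF assms(1,2), where f = "\<lambda>x. f x \<bullet> b"
          and f' = "\<lambda>x y. f' x y \<bullet> b" and F = "\<lambda>x y. F x y \<bullet> b" and G = "\<lambda>x y. G x y \<bullet> b"])
      (auto intro!: has_derivative_inner_left f F G continuous_intros cont)
qed

section \<open>Powers and exponential of a matrix of forms whose degree 0 part is a scalar\<close>

section \<open>The supertrace of the exponential in degree at most 2\<close>

lemma emult_Nil: "emult M N i k [] = M i False [] * N False k [] + M i True [] * N True k []"
  by (cases i) (auto simp: emult_def UNIV_bool wedge_Nil parity_def)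

lemma emult_single:
  "emult M N i k [t] = (\<Sum>j\<in>UNIV. (if i = j then 1 else -1) * (M i j [] * N j k [t]) + M i j [t] * N j k [])"
  by (cases i) (auto simp: emult_def UNIV_bool wedge_single parity_def)

text \<open>The sign appears only where an odd entry of \<open>M\<close> passes the degree 1 part of
  \<open>N\<close>; the parts of degree 0 and 2 commute with it.\<close>

lemma emult_pair:
  "emult M N i k [t, u] = (\<Sum>j\<in>UNIV. M i j [] * N j k [t, u] +
     (if i = j then 1 else -1) * (M i j [t] * N j k [u] - M i j [u] * N j k [t]) + M i j [t, u] * N j k [])"
  by (cases i) (auto simp: emult_def UNIV_bool wedge_pair parity_def)

context
  fixes M :: "'t eform" and m :: complex
  assumes deg0: "M False False [] = m" "M True True [] = m" "M False True [] = 0" "M True False [] = 0"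
    and deg1: "\<And>t. M False False [t] = 0" "\<And>t. M True True [t] = 0"
    and deg2: "\<And>t u. M False False [t, u] = 0"
begin

lemma epow_deg0:
  "epow M k False False [] = m ^ k" "epow M k True True [] = m ^ k"
  "epow M k False True [] = 0" "epow M k True False [] = 0"
  by (induction k) (simp_all add: eone_def zero_form_def emult_Nil deg0)

text \<open>The degree 0 part is \<open>m\<close> times the identity and hence central, so each of
  the \<open>k\<close> positions of the degree 1 factor contributes equally. At \<open>k = 0\<close>
  the truncated exponent is harmless, as the factor \<open>of_nat k\<close> vanishes.\<close>

lemma epow_deg1:
  "epow M k False False [t] = 0" "epow M k True True [t] = 0"
  "epow M k False True [t] = of_nat k * m ^ (k - 1) * M False True [t]"
  "epow M k True False [t] = of_nat k * m ^ (k - 1) * M True False [t]"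
proof (induction k)
  case (Suc k)
  note step = emult_single UNIV_bool deg0 deg1 epow_deg0 Suc
  have k: "k = 0 \<or> m * m ^ (k - Suc 0) = m ^ k" by (cases k) auto
  {
    case 1 show ?case by (simp add: step)
  next
    case 2 show ?case by (simp add: step)
  next
    case 3 show ?case using k by (auto simp: step algebra_simps)
  next
    case 4 show ?case using k by (auto simp: step algebra_simps)
  }
qed (simp_all add: eone_def zero_form_def)

text \<open>Degree 2 comes from one degree 2 factor (\<open>k\<close> positions) or from two degree
  1 factors (\<open>k * (k - 1) / 2\<close> pairs of positions, with the Koszul sign). Doubling both
  sides avoids the fraction.\<close>

lemma epow_deg2:
  "2 * epow M k False False [t, u] = - of_nat (k * (k - 1)) * m ^ (k - 2) *
     (M False True [t] * M True False [u] - M False True [u] * M True False [t])"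
  "2 * epow M k True True [t, u] = 2 * of_nat k * m ^ (k - 1) * M True True [t, u] -
     of_nat (k * (k - 1)) * m ^ (k - 2) *
     (M True False [t] * M False True [u] - M True False [u] * M False True [t])"
proof (induction k)
  case (Suc k)
  define A where "A = of_nat (k * (k - 1)) * m ^ (k - 2)"
  define B where "B = of_nat k * m ^ (k - 1)"
  define X where "X = M False True [t] * M True False [u] - M False True [u] * M True False [t]"
  define Y where "Y = M True False [t] * M False True [u] - M True False [u] * M False True [t]"
  \<comment> \<open>\<open>B\<close> and \<open>A\<close> are the first and second derivatives of
    \<open>m ^ k\<close> in \<open>m\<close>; \<open>B'\<close> and \<open>A'\<close> are the
    product rules for \<open>m * m ^ k\<close>.\<close>
  have B': "of_nat (Suc k) * m ^ (Suc k - 1) = m * B + m ^ k"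
    unfolding B_def by (cases k) (auto simp: algebra_simps)
  have A': "of_nat (Suc k * (Suc k - 1)) * m ^ (Suc k - 2) = m * A + 2 * B"
    unfolding A_def B_def by (cases k; cases "k - 1") (auto simp: algebra_simps)
  note step = emult_pair UNIV_bool deg0 deg1 deg2 epow_deg0 epow_deg1
  {
    case 1
    have "2 * epow M (Suc k) False False [t, u] = m * (2 * epow M k False False [t, u]) - 2 * B * X"
      by (simp add: step B_def X_def algebra_simps)
    also have "2 * epow M k False False [t, u] = - A * X"
      using Suc(1) by (simp add: A_def X_def)
    finally show ?case
      unfolding X_def[symmetric] mult_minus_left A' by (simp add: algebra_simps)
  next
    case 2
    have "2 * epow M (Suc k) True True [t, u] =
        m * (2 * epow M k True True [t, u]) + 2 * m ^ k * M True True [t, u] - 2 * B * Y"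
      by (simp add: step B_def Y_def algebra_simps)
    also have "2 * epow M k True True [t, u] = 2 * B * M True True [t, u] - A * Y"
      using Suc(2) by (simp add: A_def B_def Y_def mult.assoc)
    finally show ?case
      unfolding Y_def[symmetric] mult.assoc[of 2 "of_nat (Suc k)"] A' B' by (simp add: algebra_simps)
  }
qed (simp_all add: eone_def zero_form_def)

text \<open>The coefficient series are the exponential series and its first two derivatives, so each
  sums to \<open>exp m\<close>. The two diagonal entries contain \<open>- X / 2\<close> and
  \<open>X / 2\<close>, which add up in the supertrace instead of cancelling.\<close>

lemma supertrace_eexp_low_degree:
  "supertrace (eexp M) [] = 0"
  "supertrace (eexp M) [t] = 0"
  "supertrace (eexp M) [t, u] = - exp m * (M True True [t, u] +
     (M False True [t] * M True False [u] - M False True [u] * M True False [t]))"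
proof -
  show "supertrace (eexp M) [] = 0"
    by (simp add: supertrace_def eexp_def epow_deg0)
  show "supertrace (eexp M) [t] = 0"
    by (simp add: supertrace_def eexp_def epow_deg1)
  define X where "X = M False True [t] * M True False [u] - M False True [u] * M True False [t]"
  have e: "(\<lambda>k. m ^ k / fact k) sums exp m"
    using exp_converges[of m] by (simp add: scaleR_conv_of_real field_simps)
  have e1: "(\<lambda>k. of_nat k * m ^ (k - 1) / fact k) sums exp m"
  \<comment> \<open>The term at index 0 vanishes; shifting the index recovers the exponential
    series.\<close>
  proof (rule sums_Suc_imp)
    have "of_nat (Suc k) * m ^ (Suc k - 1) / fact (Suc k) = m ^ k / fact k" for k
      by (simp add: fact_Suc del: of_nat_Suc)
    with e show "(\<lambda>k. of_nat (Suc k) * m ^ (Suc k - 1) / fact (Suc k)) sums exp m" by simp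
  qed simp
  have e2: "(\<lambda>k. of_nat (k * (k - 1)) * m ^ (k - 2) / fact k) sums exp m"
  proof (rule sums_Suc_imp)
    have "of_nat (Suc k * (Suc k - 1)) * m ^ (Suc k - 2) / fact (Suc k) =
        of_nat k * m ^ (k - 1) / fact k" for k
      unfolding of_nat_mult fact_Suc by (cases k) (simp_all add: field_simps del: of_nat_Suc)
    with e1 show "(\<lambda>k. of_nat (Suc k * (Suc k - 1)) * m ^ (Suc k - 2) / fact (Suc k)) sums exp m"
      by simp
  qed simp
  have "(\<lambda>k. - (of_nat (k * (k - 1)) * m ^ (k - 2) / fact k) * (X / 2)) sums (- exp m * (X / 2))"
    by (intro sums_mult2 sums_minus e2)
  moreover have "epow M k False False [t, u] = - (of_nat (k * (k - 1)) * m ^ (k - 2)) * (X / 2)" for k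
  proof -
    have "epow M k False False [t, u] = (2 * epow M k False False [t, u]) / 2" by simp
    then show ?thesis unfolding epow_deg2(1) X_def by simp
  qed
  ultimately have F: "eexp M False False [t, u] = - exp m * (X / 2)"
    unfolding eexp_def by (intro sums_unique[symmetric]) (simp add: mult.commute)
  have "(\<lambda>k. of_nat k * m ^ (k - 1) / fact k * M True True [t, u] +
      of_nat (k * (k - 1)) * m ^ (k - 2) / fact k * (X / 2)) sums
      (exp m * M True True [t, u] + exp m * (X / 2))"
    by (intro sums_add sums_mult2 e1 e2)
  moreover have "epow M k True True [t, u] = of_nat k * m ^ (k - 1) * M True True [t, u] +
      of_nat (k * (k - 1)) * m ^ (k - 2) * (X / 2)" for k
  proof -
    have "epow M k True True [t, u] = (2 * epow M k True True [t, u]) / 2" by simp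
    then show ?thesis unfolding epow_deg2(2) X_def by (simp add: field_simps)
  qed
  ultimately have "eexp M True True [t, u] = exp m * M True True [t, u] + exp m * (X / 2)"
    unfolding eexp_def by (intro sums_unique[symmetric]) (simp add: add_divide_distrib mult.commute)
  then show "supertrace (eexp M) [t, u] = - exp m * (M True True [t, u] +
     (M False True [t] * M True False [u] - M False True [u] * M True False [t]))"
    by (simp add: supertrace_def F X_def[symmetric] algebra_simps)
qed

end

section \<open>Algebra and calculus of the extended form, then the curvature in a frame\<close>

section \<open>The curvature of the superconnection\<close>

lemma ext_sym: "sym_bilinear Q \<Longrightarrow> ext Q x y = ext Q y x"
  unfolding ext_def sym_bilinear_def by (subst sum.swap) (simp add: mult.commute mult.left_commute)

lemma ext_add_left: "ext Q (x + y) z = ext Q x z + ext Q y z"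
  by (simp add: ext_def algebra_simps sum.distrib)

lemma ext_add_right: "ext Q z (x + y) = ext Q z x + ext Q z y"
  by (simp add: ext_def algebra_simps sum.distrib)

lemma ext_scale_left: "ext Q (c *s x) z = c * ext Q x z"
  by (simp add: ext_def algebra_simps sum_distrib_left)

lemma ext_scale_right: "ext Q z (c *s x) = c * ext Q z x"
  by (simp add: ext_def algebra_simps sum_distrib_left)

lemma ext_zero: "ext Q 0 z = 0" "ext Q z 0 = 0"
  by (simp_all add: ext_def)

lemma ext_sum_left: "ext Q (\<Sum>i\<in>A. f i) z = (\<Sum>i\<in>A. ext Q (f i) z)"
  by (induction A rule: infinite_finite_induct) (auto simp: ext_zero ext_add_left)

lemma ext_sum_right: "ext Q z (\<Sum>i\<in>A. f i) = (\<Sum>i\<in>A. ext Q z (f i))"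
  by (induction A rule: infinite_finite_induct) (auto simp: ext_zero ext_add_right)

text \<open>Boundedness is automatic in finite dimension; it provides the product rule
  \<open>has_derivative_ext\<close>.\<close>

lemma bounded_bilinear_ext:
  "bounded_bilinear (ext Q :: 'k::{euclidean_space,real_normed_field} ^ 'd \<Rightarrow> 'k ^ 'd \<Rightarrow> 'k)"
proof -
  have "bilinear (ext Q :: 'k ^ 'd \<Rightarrow> 'k ^ 'd \<Rightarrow> 'k)"
    unfolding bilinear_def
    by (auto intro!: linearI simp: ext_add_left ext_add_right)
      (simp_all add: ext_def scaleR_sum_right)
  then show ?thesis by (simp add: bilinear_conv_bounded_bilinear)
qed

lemmas has_derivative_ext = bounded_bilinear.FDERIV[OF bounded_bilinear_ext]

lemma of_real_of_rat: "of_real (of_rat q) = (of_rat q :: 'k::{field_char_0,real_field})"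
  by (cases q) (simp add: of_rat_rat)

lemma cnj_of_rat: "cnj (of_rat q) = of_rat q"
  by (cases q) (simp add: of_rat_rat)

lemma ext_complexify: "ext Q (complexify x) (complexify y) = of_real (ext Q x y)"
  by (simp add: ext_def complexify_def of_real_of_rat)

text \<open>The Gram matrix is rational and therefore fixed by conjugation.\<close>

lemma cnj_ext: "cnj (ext Q x y) = ext Q (conjv x) (conjv y)"
  by (simp add: ext_def conjv_def cnj_of_rat)

lemma conjv_conjv [simp]: "conjv (conjv x) = x"
  by (simp add: conjv_def vec_eq_iff)

lemma conjv_complexify [simp]: "conjv (complexify x) = complexify x"
  by (simp add: conjv_def complexify_def vec_eq_iff)

lemma conjv_scale: "conjv (c *s x) = cnj c *s conjv x"
  by (simp add: conjv_def vec_eq_iff)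

lemma conjv_add: "conjv (x + y) = conjv x + conjv y"
  by (simp add: conjv_def vec_eq_iff)

lemma bounded_linear_conjv: "bounded_linear conjv"
  by (simp add: linear_conv_bounded_linear[symmetric])
    (auto intro!: linearI simp: conjv_def vec_eq_iff)

lemmas has_derivative_conjv = bounded_linear.has_derivative[OF bounded_linear_conjv]

text \<open>\<open>frechet_derivative\<close> is a choice from the set of derivatives, and functions
  that agree near \<open>w\<close> have the same set. This allows formulas valid only on an open set
  to be differentiated.\<close>

lemma frechet_derivative_cong_open:
  assumes "open U" "w \<in> U" "\<And>x. x \<in> U \<Longrightarrow> f x = g x"
  shows "frechet_derivative f (at w) = frechet_derivative g (at w)"
proof -
  have "(f has_derivative D) (at w) \<longleftrightarrow> (g has_derivative D) (at w)" for D
    using has_derivative_transform_within_open[of f D w UNIV U g]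
      has_derivative_transform_within_open[of g D w UNIV U f] assms by auto
  then show ?thesis by (simp add: frechet_derivative_def)
qed

lemma ext_deriv_const: "ext_deriv (\<lambda>_. \<alpha>) w ts = 0"
  by (simp add: ext_deriv_def)

lemma ext_deriv_short:
  "ext_deriv A w [] = 0"
  "ext_deriv A w [t] = frechet_derivative (\<lambda>w'. A w' []) (at w) t"
  "ext_deriv A w [t, u] = frechet_derivative (\<lambda>w'. A w' [u]) (at w) t -
     frechet_derivative (\<lambda>w'. A w' [t]) (at w) u"
  by (simp_all add: ext_deriv_def numeral_2_eq_2)

lemma frame_coeff_scale: "f \<noteq> 0 \<Longrightarrow> frame_coeff f (c *s f) = c"
  unfolding frame_coeff_def by (rule the_equality) auto

section \<open>The Chern connection of the tautological bundle in the frame \<sigma>\<close>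

locale framed_period_chart =
  fixes Q :: "rat ^ 'd \<Rightarrow> rat ^ 'd \<Rightarrow> rat"
    and U :: "(complex ^ 'n) set"
    and \<sigma> :: "complex ^ 'n \<Rightarrow> complex ^ 'd"
  assumes Q_sym: "sym_bilinear Q"
    and chart: "framed_chart Q U \<sigma>"
begin

definition d\<sigma> :: "complex ^ 'n \<Rightarrow> complex ^ 'n \<Rightarrow> complex ^ 'd" where
  "d\<sigma> w = frechet_derivative \<sigma> (at w)"

text \<open>This is -2 times the squared hermitian length of \<sigma>. It is real, but kept complex
  so that it can be divided by directly.\<close>

definition norm_sq :: "complex ^ 'n \<Rightarrow> complex" where
  "norm_sq w = ext Q (\<sigma> w) (conjv (\<sigma> w))"

text \<open>The classical formula: the (1,0)-part of the logarithmic derivative of the squared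
  length of the frame; the factor -1/2 of the metric cancels.\<close>

definition conn :: "complex ^ 'n \<Rightarrow> complex ^ 'n \<Rightarrow> complex" where
  "conn w t = ext Q (d\<sigma> w t) (conjv (\<sigma> w)) / norm_sq w"

lemma open_U: "open U"
  using chart by (simp add: framed_chart_def)

lemma Ck_\<sigma>: "Ck_on k U \<sigma>"
  using chart by (simp add: framed_chart_def holomorphic_map_def)

lemma has_derivative_\<sigma>: "w \<in> U \<Longrightarrow> (\<sigma> has_derivative d\<sigma> w) (at w)"
  unfolding d\<sigma>_def using Ck_\<sigma>[of "Suc 0"] open_U
  by (simp add: differentiable_on_eq_differentiable_at flip: frechet_derivative_works)

lemma d\<sigma>_scale: "w \<in> U \<Longrightarrow> d\<sigma> w (c *s t) = c *s d\<sigma> w t"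
  using chart by (simp add: framed_chart_def holomorphic_map_def d\<sigma>_def Vector_Spaces.linear_iff)

lemma d\<sigma>_add: "w \<in> U \<Longrightarrow> d\<sigma> w (t + u) = d\<sigma> w t + d\<sigma> w u"
  by (rule linear_add[OF has_derivative_linear[OF has_derivative_\<sigma>]])

lemma has_derivative_d\<sigma>:
  "w \<in> U \<Longrightarrow> ((\<lambda>w. d\<sigma> w t) has_derivative frechet_derivative (\<lambda>w. d\<sigma> w t) (at w)) (at w)"
  unfolding d\<sigma>_def using Ck_\<sigma>[of "Suc (Suc 0)"] open_U
  by (simp add: differentiable_on_eq_differentiable_at flip: frechet_derivative_works)

text \<open>Removes the second derivatives of \<sigma> from the exterior derivative of the
  connection form.\<close>

lemma second_derivative_\<sigma>_symmetric:
  assumes "w \<in> U"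
  shows "frechet_derivative (\<lambda>w. d\<sigma> w t) (at w) u = frechet_derivative (\<lambda>w. d\<sigma> w u) (at w) t"
proof (rule second_derivative_symmetric[where F = "\<lambda>w. frechet_derivative (\<lambda>w. d\<sigma> w t) (at w)"
      and G = "\<lambda>w. frechet_derivative (\<lambda>w. d\<sigma> w u) (at w)", OF open_U assms])
  have "continuous_on U (\<lambda>w. frechet_derivative (\<lambda>w. d\<sigma> w t) (at w) u)" for t u
    using Ck_\<sigma>[of "Suc (Suc 0)"] by (simp add: d\<sigma>_def)
  then show "continuous_on U (\<lambda>w. frechet_derivative (\<lambda>w. d\<sigma> w t) (at w) u)"
    "continuous_on U (\<lambda>w. frechet_derivative (\<lambda>w. d\<sigma> w u) (at w) t)" by auto
qed (use has_derivative_\<sigma> has_derivative_d\<sigma> in auto)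

text \<open>\<open>period_domain\<close> provides some representative
  \<open>u = c *s \<sigma> w\<close> of the line; rescaling by \<open>c\<close> multiplies the two
  values by the square of \<open>c\<close> and of its modulus.\<close>

lemma isotropic_negative:
  assumes "w \<in> U"
  shows "ext Q (\<sigma> w) (\<sigma> w) = 0" "Re (norm_sq w) < 0"
proof -
  have "cline (\<sigma> w) \<in> period_domain Q"
    using chart assms by (auto simp: framed_chart_def)
  then obtain u where u: "cline (\<sigma> w) = cline u" "ext Q u u = 0" "Re (ext Q u (conjv u)) < 0"
    by (auto simp: period_domain_def)
  have "u \<in> cline u" by (auto simp: cline_def intro!: image_eqI[of _ _ 1])
  with u(1) obtain c where c: "u = c *s \<sigma> w" by (auto simp: cline_def)
  have n: "ext Q u (conjv u) = of_real ((cmod c)\<^sup>2) * norm_sq w"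
    unfolding c complex_norm_square norm_sq_def by (simp add: ext_scale_left ext_scale_right conjv_scale)
  have "c \<noteq> 0" using u(3) n by auto
  then show "ext Q (\<sigma> w) (\<sigma> w) = 0"
    using u(2) unfolding c by (simp add: ext_scale_left ext_scale_right)
  have "(cmod c)\<^sup>2 * Re (norm_sq w) < 0" using u(3) n by simp
  then show "Re (norm_sq w) < 0" by (simp add: mult_less_0_iff)
qed

lemma cnj_norm_sq: "cnj (norm_sq w) = norm_sq w"
  unfolding norm_sq_def cnj_ext using ext_sym[OF Q_sym] by simp

lemma norm_sq_nonzero: "w \<in> U \<Longrightarrow> norm_sq w \<noteq> 0"
  using isotropic_negative(2) by force

lemma \<sigma>_nonzero: "w \<in> U \<Longrightarrow> \<sigma> w \<noteq> 0"
  using chart by (auto simp: framed_chart_def)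

text \<open>Differentiating \<open>ext Q (\<sigma> w) (\<sigma> w) = 0\<close>: the image of the
  differential is tangent to the isotropic cone.\<close>

lemma ext_d\<sigma>_\<sigma>:
  assumes "w \<in> U"
  shows "ext Q (d\<sigma> w t) (\<sigma> w) = 0"
proof -
  have "((\<lambda>w. ext Q (\<sigma> w) (\<sigma> w)) has_derivative
      (\<lambda>t. ext Q (\<sigma> w) (d\<sigma> w t) + ext Q (d\<sigma> w t) (\<sigma> w))) (at w)"
    by (intro has_derivative_ext has_derivative_\<sigma> assms)
  moreover have "((\<lambda>w. ext Q (\<sigma> w) (\<sigma> w)) has_derivative (\<lambda>t. 0)) (at w)"
    by (rule has_derivative_transform_within_open[OF has_derivative_const[of 0] open_U assms])
      (simp add: isotropic_negative)
  ultimately have "(\<lambda>t. ext Q (\<sigma> w) (d\<sigma> w t) + ext Q (d\<sigma> w t) (\<sigma> w)) = (\<lambda>t. 0)"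
    by (rule has_derivative_unique)
  from fun_cong[OF this, of t] show ?thesis
    using ext_sym[OF Q_sym, of "\<sigma> w"] by simp
qed

lemma cnj_conn: "cnj (conn w t) * norm_sq w = ext Q (\<sigma> w) (conjv (d\<sigma> w t))" if "w \<in> U"
  using that norm_sq_nonzero[OF that] ext_sym[OF Q_sym, of "conjv (d\<sigma> w t)"]
  by (simp add: conn_def cnj_norm_sq cnj_ext)

lemma has_derivative_norm_sq:
  assumes "w \<in> U"
  shows "(norm_sq has_derivative (\<lambda>t. (conn w t + cnj (conn w t)) * norm_sq w)) (at w)"
proof -
  have "(norm_sq has_derivative
      (\<lambda>t. ext Q (\<sigma> w) (conjv (d\<sigma> w t)) + ext Q (d\<sigma> w t) (conjv (\<sigma> w)))) (at w)"
    unfolding norm_sq_def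
    by (intro has_derivative_ext has_derivative_conjv has_derivative_\<sigma> assms)
  moreover have "ext Q (d\<sigma> w t) (conjv (\<sigma> w)) = conn w t * norm_sq w" for t
    using norm_sq_nonzero[OF assms] by (simp add: conn_def)
  ultimately show ?thesis
    by (simp add: distrib_right cnj_conn[OF assms] add.commute)
qed

lemma herm_\<sigma>: "herm Q (a *s \<sigma> w) (b *s \<sigma> w) = - (1/2) * a * cnj b * norm_sq w"
  by (simp add: herm_def norm_sq_def ext_scale_left ext_scale_right conjv_scale)

lemma linear_conn: "w \<in> U \<Longrightarrow> Vector_Spaces.linear (*s) (*) (conn w)"
  unfolding Vector_Spaces.linear_iff
  by (simp add: conn_def d\<sigma>_scale d\<sigma>_add ext_add_left ext_scale_left add_divide_distrib
      vec.vector_space_axioms) (simp add: vector_space_def algebra_simps)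

text \<open>Compatibility with the metric fixes only the real part of \<theta>; complex linearity,
  applied to \<open>\<i> *s t\<close>, then fixes the imaginary part.\<close>

lemma chern_form_eq:
  assumes "w \<in> U"
  shows "chern_form Q \<sigma> w = conn w"
proof -
  have D: "frechet_derivative (\<lambda>w'. herm Q (\<sigma> w') (\<sigma> w')) (at w) =
      (\<lambda>t. - (1/2) * ((conn w t + cnj (conn w t)) * norm_sq w))"
  proof -
    have "(\<lambda>w'. herm Q (\<sigma> w') (\<sigma> w')) = (\<lambda>w'. - (1/2) * norm_sq w')"
      using herm_\<sigma>[of 1 _ 1] by simp
    moreover have "((\<lambda>w'. - (1/2) * norm_sq w') has_derivative
       (\<lambda>t. - (1/2) * ((conn w t + cnj (conn w t)) * norm_sq w))) (at w)"
      by (rule has_derivative_mult_right[OF has_derivative_norm_sq[OF assms]])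
    ultimately show ?thesis by (metis (no_types) frechet_derivative_at)
  qed
  have rhs: "herm Q (a *s \<sigma> w) (\<sigma> w) + herm Q (\<sigma> w) (a *s \<sigma> w) =
      - (1/2) * ((a + cnj a) * norm_sq w)" for a
    using herm_\<sigma>[of a w 1] herm_\<sigma>[of 1 w a] by (simp add: algebra_simps)
  show ?thesis
    unfolding chern_form_def D rhs
  proof (rule the_equality)
    fix \<theta> assume \<theta>: "Vector_Spaces.linear (*s) (*) \<theta> \<and> (\<forall>t. - (1/2) * ((conn w t + cnj (conn w t)) * norm_sq w) =
      - (1/2) * ((\<theta> t + cnj (\<theta> t)) * norm_sq w))"
    have re: "Re (\<theta> t) = Re (conn w t)" for t
    proof -
      have "conn w t + cnj (conn w t) = \<theta> t + cnj (\<theta> t)"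
        using \<theta> norm_sq_nonzero[OF assms] by simp
      from arg_cong[OF this, of Re] show ?thesis by simp
    qed
    have "Im (\<theta> t) = Im (conn w t)" for t
    proof -
      have "\<theta> (\<i> *s t) = \<i> * \<theta> t"
        using \<theta> by (simp add: Vector_Spaces.linear_iff)
      moreover have "conn w (\<i> *s t) = \<i> * conn w t"
        using linear_conn[OF assms] by (simp add: Vector_Spaces.linear_iff)
      ultimately show ?thesis using re[of "\<i> *s t"] by simp
    qed
    with re show "\<theta> = conn w" by (auto intro: complex_eqI)
  qed (use linear_conn assms in auto)
qed

lemma s_map_scale: "s_map Q v (c *s u) = c * s_map Q v u"
  by (simp add: s_map_def ext_scale_left)

text \<open>On a line the adjoint is found by testing against \<sigma> alone: the coefficient solves
  one scalar equation, in which \<open>norm_sq w\<close> is real.\<close>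

lemma frame_coeff_s_adj:
  assumes "w \<in> U"
  shows "frame_coeff (\<sigma> w) (s_adj Q v (cline (\<sigma> w)) 1) = - 2 * cnj (s_map Q v (\<sigma> w)) / norm_sq w"
    (is "_ = ?c")
proof -
  have N: "norm_sq w \<noteq> 0" by (rule norm_sq_nonzero[OF assms])
  have cc: "cnj ?c = - 2 * s_map Q v (\<sigma> w) / norm_sq w" by (simp add: cnj_norm_sq)
  have "s_adj Q v (cline (\<sigma> w)) 1 = ?c *s \<sigma> w"
    unfolding s_adj_def
  proof (rule the_equality, intro conjI ballI)
    show "?c *s \<sigma> w \<in> cline (\<sigma> w)" unfolding cline_def by blast
  next
    fix u' assume "u' \<in> cline (\<sigma> w)"
    then obtain k where k: "u' = k *s \<sigma> w" by (auto simp: cline_def)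
    show "s_map Q v u' * cnj 1 = herm Q u' (?c *s \<sigma> w)"
      unfolding k herm_\<sigma> cc s_map_scale using N by simp
  next
    fix u assume u: "u \<in> cline (\<sigma> w) \<and> (\<forall>u'\<in>cline (\<sigma> w). s_map Q v u' * cnj 1 = herm Q u' u)"
    then obtain b where b: "u = b *s \<sigma> w" by (auto simp: cline_def)
    have "1 *s \<sigma> w \<in> cline (\<sigma> w)" unfolding cline_def by blast
    with u have "s_map Q v (1 *s \<sigma> w) = herm Q (1 *s \<sigma> w) u" by fastforce
    then have "cnj (s_map Q v (\<sigma> w)) = cnj (- (1/2) * cnj b * norm_sq w)"
      unfolding b herm_\<sigma> s_map_scale by simp
    then have "b = ?c" using N by (simp add: cnj_norm_sq)
    then show "u = ?c *s \<sigma> w" using b by simp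
  qed
  then show ?thesis by (simp only: frame_coeff_scale[OF \<sigma>_nonzero[OF assms]])
qed

section \<open>Covariant derivatives and the entries of the curvature matrix\<close>

definition \<kappa> :: complex where "\<kappa> = \<i> * of_real (sqrt (2 * pi))"

lemma \<kappa>_sq: "\<kappa> * \<kappa> = - 2 * of_real pi"
proof -
  have "\<kappa> * \<kappa> = (\<i> * \<i>) * of_real (sqrt (2 * pi) * sqrt (2 * pi))"
    unfolding \<kappa>_def of_real_mult by (simp only: ac_simps)
  also have "sqrt (2 * pi) * sqrt (2 * pi) = 2 * pi"
    by (rule real_sqrt_mult_self[THEN trans]) simp
  finally show ?thesis by simp
qed

abbreviation s_coeff :: "real ^ 'd \<Rightarrow> complex ^ 'n \<Rightarrow> complex" where
  "s_coeff v w \<equiv> s_map Q v (\<sigma> w)"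

abbreviation s_adj_coeff :: "real ^ 'd \<Rightarrow> complex ^ 'n \<Rightarrow> complex" where
  "s_adj_coeff v w \<equiv> - 2 * cnj (s_coeff v w) / norm_sq w"

text \<open>The covariant derivative of \<open>s_v\<close> as a section of Hom(L, O), evaluated on
  the frame: the derivative of \<open>s_v(\<sigma>)\<close> minus \<open>s_v\<close> of the
  derivative of \<sigma>.\<close>

definition ds_cov :: "real ^ 'd \<Rightarrow> complex ^ 'n \<Rightarrow> complex ^ 'n \<Rightarrow> complex" where
  "ds_cov v w t = s_map Q v (d\<sigma> w t) - s_coeff v w * conn w t"

lemma has_derivative_s_coeff:
  assumes "w \<in> U"
  shows "(s_coeff v has_derivative (\<lambda>t. s_map Q v (d\<sigma> w t))) (at w)"
  unfolding s_map_def
  by (rule has_derivative_eq_rhs[OF has_derivative_ext[OF has_derivative_\<sigma>[OF assms] has_derivative_const]])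
    (simp add: ext_zero)

text \<open>Arranged so that adding the connection term of L leaves the adjoint of
  \<open>ds_cov\<close>.\<close>

lemma has_derivative_s_adj_coeff:
  assumes "w \<in> U"
  shows "(s_adj_coeff v has_derivative
    (\<lambda>t. - 2 * cnj (ds_cov v w t) / norm_sq w - s_adj_coeff v w * conn w t)) (at w)"
proof -
  have c: "((\<lambda>w. cnj (s_coeff v w)) has_derivative (\<lambda>t. cnj (s_map Q v (d\<sigma> w t)))) (at w)"
    by (rule bounded_linear.has_derivative[OF bounded_linear_cnj has_derivative_s_coeff[OF assms]])
  show ?thesis
    by (rule has_derivative_eq_rhs[OF has_derivative_divide[OF has_derivative_mult_right[OF c]
          has_derivative_norm_sq[OF assms] norm_sq_nonzero[OF assms]]])
      (use norm_sq_nonzero[OF assms] in \<open>auto simp: ds_cov_def field_simps cnj_norm_sq\<close>)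
qed

lemma has_derivative_conn:
  assumes "w \<in> U"
  shows "((\<lambda>w. conn w u) has_derivative
    (\<lambda>t. (ext Q (frechet_derivative (\<lambda>w. d\<sigma> w u) (at w) t) (conjv (\<sigma> w)) +
          ext Q (d\<sigma> w u) (conjv (d\<sigma> w t))) / norm_sq w - conn w u * (conn w t + cnj (conn w t)))) (at w)"
  unfolding conn_def[of _ u]
  by (rule has_derivative_eq_rhs[OF has_derivative_divide[OF has_derivative_ext[OF has_derivative_d\<sigma>[OF assms]
          has_derivative_conjv[OF has_derivative_\<sigma>[OF assms]]]
        has_derivative_norm_sq[OF assms] norm_sq_nonzero[OF assms]]])
    (use norm_sq_nonzero[OF assms] in \<open>auto simp: field_simps\<close>)

lemma superconn_frame_False:
  assumes "w \<in> U"
  shows "superconn Q \<sigma> v (frame_section False) w False ts = 0"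
    "superconn Q \<sigma> v (frame_section False) w True ts = zero_form (\<kappa> * s_adj_coeff v w) ts"
proof -
  have "wedge (parity (zero_form 0)) \<alpha> us = 0" for \<alpha> and us :: "(complex ^ 'n) list"
    by (simp add: wedge_def parity_def zero_form_def)
  then show "superconn Q \<sigma> v (frame_section False) w False ts = 0"
    "superconn Q \<sigma> v (frame_section False) w True ts = zero_form (\<kappa> * s_adj_coeff v w) ts"
    by (simp_all add: superconn_def frame_section_def eone_def ext_deriv_const
        frame_coeff_s_adj[OF assms] \<kappa>_def parity_def zero_form_def)
qed

lemma superconn_frame_True:
  assumes "w \<in> U"
  shows "superconn Q \<sigma> v (frame_section True) w False ts = zero_form (\<kappa> * s_coeff v w) ts"
    "superconn Q \<sigma> v (frame_section True) w True [] = 0"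
    "superconn Q \<sigma> v (frame_section True) w True [t] = conn w t"
  by (simp_all add: superconn_def frame_section_def eone_def ext_deriv_const wedge_Nil wedge_single
      chern_form_eq[OF assms] \<kappa>_def parity_def zero_form_def one_form_def)

text \<open>In degree 1 the connection terms complete the derivatives of the coefficients of
  \<open>s_v\<close> and its adjoint to covariant ones. In degree 2 the connection form \<theta>
  contributes only its exterior derivative, since \<theta> \<and> \<theta> = 0.\<close>

lemma curvature_values:
  fixes v :: "real ^ 'd"
  assumes "w \<in> U"
  defines "m \<equiv> \<kappa> * \<kappa> * (s_coeff v w * s_adj_coeff v w)"
  shows "curvature Q \<sigma> v w False False [] = m"
    "curvature Q \<sigma> v w True True [] = m"
    "curvature Q \<sigma> v w False True [] = 0"
    "curvature Q \<sigma> v w True False [] = 0"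
    "curvature Q \<sigma> v w False False [t] = 0"
    "curvature Q \<sigma> v w True True [t] = 0"
    "curvature Q \<sigma> v w False False [t, u] = 0"
    "curvature Q \<sigma> v w False True [t] = \<kappa> * ds_cov v w t"
    "curvature Q \<sigma> v w True False [t] = \<kappa> * (- 2 * cnj (ds_cov v w t) / norm_sq w)"
    "curvature Q \<sigma> v w True True [t, u] =
       (ext Q (d\<sigma> w u) (conjv (d\<sigma> w t)) - ext Q (d\<sigma> w t) (conjv (d\<sigma> w u))) / norm_sq w
       - (conn w u * cnj (conn w t) - conn w t * cnj (conn w u))"
proof -
  have fd: "frechet_derivative (\<lambda>w'. superconn Q \<sigma> v (frame_section j) w' i ts) (at w) = D"
    if "(f has_derivative D) (at w)" "\<And>w'. w' \<in> U \<Longrightarrow> superconn Q \<sigma> v (frame_section j) w' i ts = f w'"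
    for f i j ts D
    by (subst frechet_derivative_cong_open[OF open_U assms(1) that(2)])
      (simp_all only: frechet_derivative_at[OF that(1), symmetric])
  have fd0: "frechet_derivative (\<lambda>w'. superconn Q \<sigma> v (frame_section False) w' False ts) (at w) = (\<lambda>t. 0)" for ts
    by (rule fd[OF has_derivative_const]) (simp add: superconn_frame_False)
  have fd1: "frechet_derivative (\<lambda>w'. superconn Q \<sigma> v (frame_section False) w' True []) (at w) =
      (\<lambda>t. \<kappa> * (- 2 * cnj (ds_cov v w t) / norm_sq w - s_adj_coeff v w * conn w t))"
    by (rule fd[OF has_derivative_mult_right[OF has_derivative_s_adj_coeff[OF assms(1)]]])
      (simp add: superconn_frame_False zero_form_def)
  have fd2: "frechet_derivative (\<lambda>w'. superconn Q \<sigma> v (frame_section True) w' False []) (at w) =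
      (\<lambda>t. \<kappa> * s_map Q v (d\<sigma> w t))"
    by (rule fd[OF has_derivative_mult_right[OF has_derivative_s_coeff[OF assms(1)]]])
      (simp add: superconn_frame_True zero_form_def)
  have fd3: "frechet_derivative (\<lambda>w'. superconn Q \<sigma> v (frame_section True) w' True []) (at w) = (\<lambda>t. 0)"
    by (rule fd[OF has_derivative_const]) (simp add: superconn_frame_True)
  have fd4: "frechet_derivative (\<lambda>w'. superconn Q \<sigma> v (frame_section True) w' True [u]) (at w) =
    (\<lambda>t. (ext Q (frechet_derivative (\<lambda>w. d\<sigma> w u) (at w) t) (conjv (\<sigma> w)) +
          ext Q (d\<sigma> w u) (conjv (d\<sigma> w t))) / norm_sq w - conn w u * (conn w t + cnj (conn w t)))" for u
    by (rule fd[OF has_derivative_conn[OF assms(1)]]) (simp add: superconn_frame_True)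
  \<comment> \<open>Only the outer operator is unfolded; the inner one stays folded so that its
    known values on the frame can be substituted.\<close>
  have out: "superconn Q \<sigma> v (superconn Q \<sigma> v \<psi>) w i ts = (if \<not> i then
      ext_deriv (\<lambda>w'. superconn Q \<sigma> v \<psi> w' False) w ts
       + \<kappa> * (s_map Q v (\<sigma> w) * parity (superconn Q \<sigma> v \<psi> w True) ts)
     else
       ext_deriv (\<lambda>w'. superconn Q \<sigma> v \<psi> w' True) w ts
       + wedge (parity (superconn Q \<sigma> v \<psi> w True)) (one_form (conn w)) ts
       + \<kappa> * (s_adj_coeff v w * parity (superconn Q \<sigma> v \<psi> w False) ts))" for \<psi> i ts
    unfolding superconn_def[of Q \<sigma> v "superconn Q \<sigma> v \<psi>"] \<kappa>_def
      frame_coeff_s_adj[OF assms(1)] chern_form_eq[OF assms(1)] ..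
  note simps = curvature_def out ext_deriv_short wedge_Nil wedge_single wedge_pair parity_def
    superconn_frame_False[OF assms(1)] superconn_frame_True[OF assms(1)] one_form_def zero_form_def
  show "curvature Q \<sigma> v w False False [] = m"
    by (simp add: simps m_def)
  show "curvature Q \<sigma> v w True True [] = m"
    by (simp add: simps m_def)
  show "curvature Q \<sigma> v w False True [] = 0"
    by (simp add: simps)
  show "curvature Q \<sigma> v w True False [] = 0"
    by (simp add: simps)
  show "curvature Q \<sigma> v w False False [t] = 0"
    by (simp add: simps fd0[unfolded zero_form_def])
  show "curvature Q \<sigma> v w True True [t] = 0"
    by (simp add: simps fd3)
  show "curvature Q \<sigma> v w False False [t, u] = 0"
    by (simp add: simps fd0)
  show "curvature Q \<sigma> v w False True [t] = \<kappa> * ds_cov v w t"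
    by (simp add: simps fd2 ds_cov_def algebra_simps)
  show "curvature Q \<sigma> v w True False [t] = \<kappa> * (- 2 * cnj (ds_cov v w t) / norm_sq w)"
    by (simp add: simps fd1 algebra_simps)
  show "curvature Q \<sigma> v w True True [t, u] =
       (ext Q (d\<sigma> w u) (conjv (d\<sigma> w t)) - ext Q (d\<sigma> w t) (conjv (d\<sigma> w u))) / norm_sq w
       - (conn w u * cnj (conn w t) - conn w t * cnj (conn w u))"
    by (simp add: simps fd4 second_derivative_\<sigma>_symmetric[OF assms(1), of u t] algebra_simps
        add_divide_distrib diff_divide_distrib)
qed

text \<open>Instance of \<open>supertrace_eexp_low_degree\<close>. The factor \<kappa> enters only
  through its square -2\<pi>, which turns the scalar part into -2\<pi>
  h(\<open>s_v\<close>).\<close>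

lemma phi_low_degree:
  assumes "w \<in> U"
  shows "vanishes_below 2 (phi Q \<sigma> v w)"
    "phi Q \<sigma> v w [t, u] =
      - exp (of_real (- pi * ext Q v v) + 4 * of_real pi * (s_coeff v w * cnj (s_coeff v w)) / norm_sq w) *
      ((ext Q (d\<sigma> w u) (conjv (d\<sigma> w t)) - ext Q (d\<sigma> w t) (conjv (d\<sigma> w u))) / norm_sq w
       - (conn w u * cnj (conn w t) - conn w t * cnj (conn w u))
       + 4 * of_real pi * (ds_cov v w t * cnj (ds_cov v w u) - ds_cov v w u * cnj (ds_cov v w t)) / norm_sq w)"
proof -
  note st = supertrace_eexp_low_degree[of "curvature Q \<sigma> v w", OF curvature_values(1-7)[OF assms]]
  have "phi Q \<sigma> v w ts = 0" if "length ts < 2" for ts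
  proof (cases ts)
    case Nil
    then show ?thesis by (simp add: phi_def st(1))
  next
    case (Cons t us)
    then have "ts = [t]" using that by simp
    then show ?thesis by (simp add: phi_def st(2))
  qed
  then show "vanishes_below 2 (phi Q \<sigma> v w)" by (simp add: vanishes_below_def)
  have m: "\<kappa> * \<kappa> * (s_coeff v w * s_adj_coeff v w) =
      4 * of_real pi * (s_coeff v w * cnj (s_coeff v w)) / norm_sq w"
    by (simp add: \<kappa>_sq)
  have k: "\<kappa> * a * (\<kappa> * (- 2 * cnj b / norm_sq w)) - \<kappa> * b * (\<kappa> * (- 2 * cnj a / norm_sq w)) =
      4 * of_real pi * (a * cnj b - b * cnj a) / norm_sq w" for a b
  proof -
    have "\<kappa> * a * (\<kappa> * (- 2 * cnj b / norm_sq w)) - \<kappa> * b * (\<kappa> * (- 2 * cnj a / norm_sq w)) =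
      \<kappa> * \<kappa> * (- 2 * (a * cnj b - b * cnj a) / norm_sq w)"
      by (simp add: algebra_simps diff_divide_distrib)
    also have "\<dots> = 4 * of_real pi * (a * cnj b - b * cnj a) / norm_sq w"
      unfolding \<kappa>_sq by (simp add: algebra_simps diff_divide_distrib)
    finally show ?thesis .
  qed
  show "phi Q \<sigma> v w [t, u] =
      - exp (of_real (- pi * ext Q v v) + 4 * of_real pi * (s_coeff v w * cnj (s_coeff v w)) / norm_sq w) *
      ((ext Q (d\<sigma> w u) (conjv (d\<sigma> w t)) - ext Q (d\<sigma> w t) (conjv (d\<sigma> w u))) / norm_sq w
       - (conn w u * cnj (conn w t) - conn w t * cnj (conn w u))
       + 4 * of_real pi * (ds_cov v w t * cnj (ds_cov v w u) - ds_cov v w u * cnj (ds_cov v w t)) / norm_sq w)"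
    unfolding phi_def st(3) curvature_values(8-10)[OF assms] k m
    unfolding exp_add exp_of_real by (simp add: mult.assoc)
qed

end

section \<open>Expansions in an orthogonal basis and an explicit formula for the coordinates
  \<xi>\<close>

section \<open>Orthogonal bases and the coordinates of the period domain\<close>

lemma complexify_scaleR: "complexify (c *\<^sub>R x) = of_real c *s complexify x"
  by (simp add: complexify_def vec_eq_iff)

lemma complexify_sum: "complexify (\<Sum>i\<in>A. f i) = (\<Sum>i\<in>A. complexify (f i))"
  by (simp add: complexify_def vec_eq_iff)

definition re_vec :: "complex ^ 'd \<Rightarrow> real ^ 'd" where
  "re_vec y = (\<chi> i. Re (y $ i))"

definition im_vec :: "complex ^ 'd \<Rightarrow> real ^ 'd" where
  "im_vec y = (\<chi> i. Im (y $ i))"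

lemma complexify_re_im: "y = complexify (re_vec y) + \<i> *s complexify (im_vec y)"
  by (simp add: vec_eq_iff complexify_def re_vec_def im_vec_def complex_eq_iff)

lemma ext_scaleR_left: "ext Q (c *\<^sub>R x) z = c * ext Q x (z :: real ^ 'd)"
  by (simp add: ext_def algebra_simps sum_distrib_left)

lemma ext_scaleR_right: "ext Q z (c *\<^sub>R x) = c * ext Q (z :: real ^ 'd) x"
  by (simp add: ext_def algebra_simps sum_distrib_left)

lemma ext_of_real_complexify:
  "ext Q y (complexify v) = of_real (ext Q (re_vec y) v) + \<i> * of_real (ext Q (im_vec y) v)"
  by (subst complexify_re_im[of y]) (simp add: ext_add_left ext_scale_left ext_complexify)

lemma ext_re_vec: "ext Q (re_vec y) v = Re (ext Q y (complexify v))"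
  by (simp add: ext_of_real_complexify)

text \<open>Taking real parts merges the two complex parameters into \<open>a + b\<close>;
  conversely a real part is half the sum of a vector and its conjugate.\<close>

lemma neg_plane_cline: "neg_plane (cline f) = range (\<lambda>k. re_vec (k *s f))"
proof (intro equalityI subsetI)
  fix x assume "x \<in> neg_plane (cline f)"
  then obtain a b where "complexify x = a *s f + conjv (b *s f)"
    by (auto simp: neg_plane_def cline_def)
  then have "x = re_vec ((a + b) *s f)"
    by (auto simp: vec_eq_iff complexify_def re_vec_def conjv_def complex_eq_iff algebra_simps)
  then show "x \<in> range (\<lambda>k. re_vec (k *s f))" by blast
next
  fix x assume "x \<in> range (\<lambda>k. re_vec (k *s f))"
  then obtain k where x: "x = re_vec (k *s f)" by blast
  have "complexify x = (k / 2) *s f + conjv ((k / 2) *s f)"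
    by (auto simp: x vec_eq_iff complexify_def re_vec_def conjv_def complex_eq_iff add_divide_distrib diff_divide_distrib)
  then show "x \<in> neg_plane (cline f)"
    unfolding neg_plane_def cline_def by blast
qed

lemma sum_split_last_two: "(\<Sum>j=1..n+(2::nat). f j) = (\<Sum>j=1..n. f j) + f (n + 1) + (f (n + 2) :: 'b::comm_monoid_add)"
  by (simp add: numeral_2_eq_2)

locale orthogonal_frame =
  fixes Q :: "rat ^ 'd \<Rightarrow> rat ^ 'd \<Rightarrow> rat" and n :: nat and e :: "nat \<Rightarrow> real ^ 'd"
  assumes Q_sym: "sym_bilinear Q"
    and basis: "orthogonal_basis Q n e"
begin

definition sgn_e :: "nat \<Rightarrow> real" where
  "sgn_e j = (if j \<le> n then 1 else -1)"

lemma ext_basis: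
  assumes "i \<in> {1..n+2}" "j \<in> {1..n+2}"
  shows "ext Q (e i) (e j) = (if i = j then sgn_e j else 0)"
proof (cases "i = j")
  case True
  then show ?thesis
    using basis assms by (cases "j \<le> n") (auto simp: orthogonal_basis_def sgn_e_def)
qed (use basis assms in \<open>auto simp: orthogonal_basis_def\<close>)

lemma sgn_e_sq: "sgn_e j * sgn_e j = 1"
  by (simp add: sgn_e_def)

lemma basis_expansion: "v = (\<Sum>j=1..n+2. basis_coord n e j v *\<^sub>R e j)"
proof -
  have b: "inj_on e {1..n+2}" "independent (e ` {1..n+2})" "span (e ` {1..n+2}) = UNIV"
    using basis by (auto simp: orthogonal_basis_def)
  have "(\<Sum>b\<in>e ` {1..n+2}. representation (e ` {1..n+2}) v b *\<^sub>R b) = v"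
    using b by (intro real_vector.sum_representation_eq) auto
  then show ?thesis
    by (simp only: sum.reindex[OF b(1)] basis_coord_def o_def)
qed

lemma ext_sum_basis:
  assumes "j \<in> {1..n+2}"
  shows "ext Q (\<Sum>i=1..n+2. x i *\<^sub>R e i) (e j) = sgn_e j * x j"
proof -
  have "ext Q (\<Sum>i=1..n+2. x i *\<^sub>R e i) (e j) = (\<Sum>i=1..n+2. if i = j then sgn_e j * x j else 0)"
    unfolding ext_sum_left using assms by (intro sum.cong) (auto simp: ext_scaleR_left ext_basis)
  also have "\<dots> = sgn_e j * x j" using assms by simp
  finally show ?thesis .
qed

text \<open>Replaces \<open>representation\<close> by a pairing, which is visibly linear;
  \<open>sgn_e j\<close> is its own inverse.\<close>

lemma basis_coord_eq:
  assumes "j \<in> {1..n+2}"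
  shows "basis_coord n e j v = sgn_e j * ext Q v (e j)"
  using ext_sum_basis[OF assms, of "\<lambda>i. basis_coord n e i v"]
  unfolding basis_expansion[symmetric] by (simp add: sgn_e_sq flip: mult.assoc)

lemma basis_coord_basis:
  "i \<in> {1..n+2} \<Longrightarrow> j \<in> {1..n+2} \<Longrightarrow> basis_coord n e j (e i) = (if i = j then 1 else 0)"
  by (simp add: basis_coord_eq ext_basis sgn_e_sq)

lemma eq_iff_ext_basis: "y = y' \<longleftrightarrow> (\<forall>j\<in>{1..n+2}. ext Q y (e j) = ext Q y' (e j))"
proof
  assume "\<forall>j\<in>{1..n+2}. ext Q y (e j) = ext Q y' (e j)"
  then have "basis_coord n e j y = basis_coord n e j y'" if "j \<in> {1..n+2}" for j
    using that by (simp add: basis_coord_eq)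
  then show "y = y'"
    by (subst (1 2) basis_expansion) (intro sum.cong, auto)
qed simp

lemma ext_real_expansion: "ext Q y v = (\<Sum>j=1..n+2. sgn_e j * ext Q y (e j) * ext Q v (e j))"
  by (subst basis_expansion[of v])
    (auto simp only: ext_sum_right ext_scaleR_right basis_coord_eq mult_ac intro!: sum.cong)

lemma ext_complexify_expansion:
  "ext Q x (complexify v) = (\<Sum>j=1..n+2. of_real (basis_coord n e j v) * ext Q x (complexify (e j)))"
  by (subst basis_expansion[of v])
    (simp only: ext_sum_right complexify_sum complexify_scaleR ext_scale_right)

text \<open>Parseval's identity for the indefinite form, extended from real vectors by splitting
  \<open>y\<close> into real and imaginary parts.\<close>

lemma ext_expansion:
  "ext Q x y = (\<Sum>j=1..n+2. of_real (sgn_e j) * ext Q x (complexify (e j)) * ext Q y (complexify (e j)))"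
proof -
  have *: "ext Q x (complexify v) = (\<Sum>j=1..n+2. of_real (sgn_e j) * ext Q x (complexify (e j)) * of_real (ext Q v (e j)))" for v
    unfolding ext_complexify_expansion[of x v]
    by (intro sum.cong) (auto simp: basis_coord_eq)
  have "ext Q x y = ext Q x (complexify (re_vec y)) + \<i> * ext Q x (complexify (im_vec y))"
    by (subst complexify_re_im[of y]) (simp add: ext_add_right ext_scale_right)
  also have "\<dots> = (\<Sum>j=1..n+2. of_real (sgn_e j) * ext Q x (complexify (e j)) * ext Q y (complexify (e j)))"
    unfolding *[of "re_vec y"] *[of "im_vec y"] ext_of_real_complexify[of Q y]
    by (simp add: sum_distrib_left distrib_left sum.distrib mult_ac del: sum.cl_ivl_Suc One_nat_def add_2_eq_Suc')
  finally show ?thesis .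
qed

lemma ext_conjv_expansion:
  "ext Q x (conjv y) =
    (\<Sum>j=1..n+2. of_real (sgn_e j) * ext Q x (complexify (e j)) * cnj (ext Q y (complexify (e j))))"
  unfolding ext_expansion[of x "conjv y"] by (simp add: cnj_ext del: sum.cl_ivl_Suc One_nat_def add_2_eq_Suc')

text \<open>Determinant of the real-linear map taking \<open>k\<close> to the pairings of Re(k f)
  with \<open>e (n+1)\<close> and \<open>e (n+2)\<close>; it is nonzero when the plane of
  \<open>f\<close> projects isomorphically onto their span.\<close>

definition neg_det :: "complex ^ 'd \<Rightarrow> real" where
  "neg_det f = Im (ext Q f (complexify (e (n+1))) * cnj (ext Q f (complexify (e (n+2)))))"

definition plane_coeff :: "nat \<Rightarrow> complex ^ 'd \<Rightarrow> complex" where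
  "plane_coeff \<mu> f = (if \<mu> = n + 1 then \<i> * cnj (ext Q f (complexify (e (n+2))))
     else - \<i> * cnj (ext Q f (complexify (e (n+1))))) / of_real (neg_det f)"

text \<open>Cramer's rule for the vector \<open>Re (k f)\<close> of the plane with prescribed components along \<open>e\<^bsub>n+1\<^esub>\<close> and \<open>e\<^bsub>n+2\<^esub>\<close>.\<close>

lemma plane_coeff_unique:
  assumes "neg_det f \<noteq> 0" "\<mu> \<in> {n+1..n+2}"
  shows "Re (k * ext Q f (complexify (e (n+1)))) = (if \<mu> = n + 1 then -1 else 0) \<and>
     Re (k * ext Q f (complexify (e (n+2)))) = (if \<mu> = n + 2 then -1 else 0) \<longleftrightarrow>
     k = plane_coeff \<mu> f"
proof -
  define a b where "a = ext Q f (complexify (e (n+1)))" and "b = ext Q f (complexify (e (n+2)))"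
  have D: "neg_det f = Im a * Re b - Re a * Im b" by (simp add: neg_det_def a_def b_def)
  have "Re (k * a) = p \<and> Re (k * b) = q \<longleftrightarrow>
      Re k = (q * Im a - p * Im b) / neg_det f \<and> Im k = (q * Re a - p * Re b) / neg_det f" for p q
  proof -
    have nz: "Im a * Re b - Re a * Im b \<noteq> 0" using assms(1) D by simp
    show ?thesis
    proof (intro iffI conjI)
      assume *: "Re (k * a) = p \<and> Re (k * b) = q"
      then have p: "p = Re k * Re a - Im k * Im a" and q: "q = Re k * Re b - Im k * Im b" by auto
      have "q * Im a - p * Im b = Re k * neg_det f" "q * Re a - p * Re b = Im k * neg_det f"
        unfolding p q D by (simp_all add: algebra_simps)
      then show "Re k = (q * Im a - p * Im b) / neg_det f" "Im k = (q * Re a - p * Re b) / neg_det f"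
        using assms(1) by simp_all
    next
      assume *: "Re k = (q * Im a - p * Im b) / neg_det f \<and> Im k = (q * Re a - p * Re b) / neg_det f"
      have "Re (k * a) = p * neg_det f / neg_det f" "Re (k * b) = q * neg_det f / neg_det f"
        using nz by (simp_all add: * D divide_simps) (simp_all add: algebra_simps)
      then show "Re (k * a) = p" "Re (k * b) = q" using assms(1) by simp_all
    qed
  qed
  from this[of "if \<mu> = n + 1 then -1 else 0" "if \<mu> = n + 2 then -1 else 0"]
  show ?thesis
    using assms(2) unfolding plane_coeff_def a_def[symmetric] b_def[symmetric]
    by (auto simp: complex_eq_iff)
qed

text \<open>Pairings with the basis determine a vector. Those with the two negative basis vectors
  force \<open>k = plane_coeff \<mu> f\<close> (with value -1, since
  \<open>ext Q (e \<mu>) (e \<mu>) = -1\<close>), and the others then read off \<xi>.\<close>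

lemma xi_coord_cline:
  assumes "neg_det f \<noteq> 0" "\<mu> \<in> {n+1..n+2}" "\<alpha> \<in> {1..n}"
  shows "xi_coord n e \<alpha> \<mu> (cline f) = Re (plane_coeff \<mu> f * ext Q f (complexify (e \<alpha>)))"
proof -
  let ?I = "{1..n+2}"
  have mem: "e \<mu> + (\<Sum>\<beta>=1..n. \<xi> \<beta> *\<^sub>R e \<beta>) \<in> neg_plane (cline f) \<longleftrightarrow>
    (\<forall>\<beta>\<in>{1..n}. \<xi> \<beta> = Re (plane_coeff \<mu> f * ext Q f (complexify (e \<beta>))))" for \<xi>
  proof -
    define y where "y = e \<mu> + (\<Sum>\<beta>=1..n. \<xi> \<beta> *\<^sub>R e \<beta>)"
    have y: "y = (\<Sum>j=1..n+2. (if j \<le> n then \<xi> j else if j = \<mu> then 1 else 0) *\<^sub>R e j)"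
    proof -
      have "\<mu> = n + 1 \<or> \<mu> = n + 2" using assms(2) by auto
      then show ?thesis unfolding y_def sum_split_last_two by auto
    qed
    have c: "ext Q y (e j) = (if j \<le> n then \<xi> j else if j = \<mu> then -1 else 0)" if "j \<in> ?I" for j
      unfolding y ext_sum_basis[OF that] by (simp add: sgn_e_def)
    have "y \<in> neg_plane (cline f) \<longleftrightarrow> (\<exists>k. y = re_vec (k *s f))"
      unfolding neg_plane_cline by auto
    also have "\<dots> \<longleftrightarrow> (\<exists>k. \<forall>j\<in>?I. ext Q y (e j) = Re (k * ext Q f (complexify (e j))))"
      unfolding eq_iff_ext_basis ext_re_vec ext_scale_left ..
    also have "\<dots> \<longleftrightarrow> (\<exists>k. (\<forall>j\<in>{1..n}. \<xi> j = Re (k * ext Q f (complexify (e j)))) \<and>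
       Re (k * ext Q f (complexify (e (n+1)))) = (if \<mu> = n + 1 then -1 else 0) \<and>
       Re (k * ext Q f (complexify (e (n+2)))) = (if \<mu> = n + 2 then -1 else 0))"
    proof -
      have I: "?I = insert (n + 2) (insert (n + 1) {1..n})" by auto
      have "(\<forall>j\<in>?I. ext Q y (e j) = Re (k * ext Q f (complexify (e j)))) \<longleftrightarrow>
        (\<forall>j\<in>{1..n}. \<xi> j = Re (k * ext Q f (complexify (e j)))) \<and>
       Re (k * ext Q f (complexify (e (n+1)))) = (if \<mu> = n + 1 then -1 else 0) \<and>
       Re (k * ext Q f (complexify (e (n+2)))) = (if \<mu> = n + 2 then -1 else 0)" for k
      proof -
        have "(\<forall>j\<in>?I. ext Q y (e j) = Re (k * ext Q f (complexify (e j)))) \<longleftrightarrow>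
          (\<forall>j\<in>?I. (if j \<le> n then \<xi> j else if j = \<mu> then -1 else 0) = Re (k * ext Q f (complexify (e j))))"
          using c by simp
        then show ?thesis unfolding I by auto
      qed
      then show ?thesis by simp
    qed
    also have "\<dots> \<longleftrightarrow> (\<forall>\<beta>\<in>{1..n}. \<xi> \<beta> = Re (plane_coeff \<mu> f * ext Q f (complexify (e \<beta>))))"
      unfolding plane_coeff_unique[OF assms(1,2)] by simp
    finally show ?thesis unfolding y_def .
  qed
  \<comment> \<open>Extension by 0 matches the normalisation in \<open>xi_coord\<close>, which makes
    the described function unique.\<close>
  define \<xi>0 where "\<xi>0 \<beta> = (if \<beta> \<in> {1..n} then Re (plane_coeff \<mu> f * ext Q f (complexify (e \<beta>))) else 0)" for \<beta>
  have "(THE \<xi>. (\<forall>\<beta>. \<beta> \<notin> {1..n} \<longrightarrow> \<xi> \<beta> = 0) \<and>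
     e \<mu> + (\<Sum>\<beta>=1..n. \<xi> \<beta> *\<^sub>R e \<beta>) \<in> neg_plane (cline f)) = \<xi>0"
    unfolding mem by (rule the_equality) (auto simp: \<xi>0_def)
  then show ?thesis unfolding xi_coord_def using assms(3) by (simp add: \<xi>0_def)
qed

lemma bounded_linear_basis_coord: "j \<in> {1..n+2} \<Longrightarrow> bounded_linear (basis_coord n e j)"
  using linear_conv_bounded_linear basis_coord_eq[of j]
  by (auto intro!: linearI simp: linear_conv_bounded_linear[symmetric] ext_add_left ext_scaleR_left algebra_simps)

lemma has_derivative_basis_coord:
  "j \<in> {1..n+2} \<Longrightarrow> (basis_coord n e j has_derivative basis_coord n e j) (at v)"
  by (rule bounded_linear_imp_has_derivative[OF bounded_linear_basis_coord])

lemma has_derivative_gaussian: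
  "(gaussian n e has_derivative
    (\<lambda>t. - 2 * pi * gaussian n e v * (\<Sum>j=1..n+2. basis_coord n e j v * basis_coord n e j t))) (at v)"
proof -
  have "((\<lambda>v. \<Sum>j=1..n+2. (basis_coord n e j v)\<^sup>2) has_derivative
      (\<lambda>t. \<Sum>j=1..n+2. 2 * (basis_coord n e j v * basis_coord n e j t))) (at v)"
    unfolding power2_eq_square
    by (intro has_derivative_sum, rule has_derivative_eq_rhs, rule has_derivative_mult)
      (auto intro!: has_derivative_basis_coord)
  from has_derivative_exp[OF has_derivative_mult_right[OF this, of "- pi"]]
  show ?thesis
    unfolding gaussian_def
    by (rule has_derivative_eq_rhs) (simp add: sum_distrib_left[symmetric] mult_ac del: sum.cl_ivl_Suc One_nat_def add_2_eq_Suc')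
qed

lemma sum_basis_coord_mult:
  assumes "\<alpha> \<in> {1..n}"
  shows "(\<Sum>j=1..n+2. basis_coord n e j v * basis_coord n e j (e \<alpha>)) = basis_coord n e \<alpha> v"
proof -
  have "(\<Sum>j=1..n+2. basis_coord n e j v * basis_coord n e j (e \<alpha>)) =
    (\<Sum>j=1..n+2. if j = \<alpha> then basis_coord n e \<alpha> v else 0)"
    using assms by (intro sum.cong) (auto simp: basis_coord_basis)
  also have "\<dots> = basis_coord n e \<alpha> v" using assms by (simp del: sum.cl_ivl_Suc One_nat_def add_2_eq_Suc')
  finally show ?thesis .
qed

end

section \<open>Completing a negative orthonormal pair to an orthogonal basis\<close>

section \<open>Existence of adapted bases\<close>

text \<open>Pairing a linear relation with one of its vectors isolates the corresponding
  coefficient.\<close>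

lemma independent_of_orthogonal:
  fixes T :: "(real ^ 'd) set"
  assumes "finite T" "\<And>x. x \<in> T \<Longrightarrow> ext Q x x \<noteq> 0"
    and "\<And>x y. x \<in> T \<Longrightarrow> y \<in> T \<Longrightarrow> x \<noteq> y \<Longrightarrow> ext Q x y = 0"
  shows "independent T"
proof
  assume "dependent T"
  then obtain k x where x: "x \<in> T" "k x \<noteq> 0" and z: "(\<Sum>y\<in>T. k y *\<^sub>R y) = 0"
    by (auto simp: dependent_finite[OF assms(1)])
  have "0 = ext Q (\<Sum>y\<in>T. k y *\<^sub>R y) x" by (simp add: z ext_zero)
  also have "\<dots> = (\<Sum>y\<in>T. if y = x then k x * ext Q x x else 0)"
    unfolding ext_sum_left ext_scaleR_left using assms(3) x(1) by (intro sum.cong) auto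
  also have "\<dots> = k x * ext Q x x" using assms(1) x(1) by simp
  finally show False using x assms(2) by simp
qed

lemma exists_kernel_vector:
  fixes T :: "real \<times> real \<times> real \<Rightarrow> real \<times> real"
  assumes "linear T"
  shows "\<exists>x. x \<noteq> 0 \<and> T x = 0"
proof (rule ccontr)
  assume "\<not> ?thesis"
  then have "inj T" using linear_injective_0[OF assms] by blast
  then have "dim (range T) = dim (UNIV :: (real \<times> real \<times> real) set)"
    by (intro dim_image_eq assms) auto
  moreover have "dim (range T) \<le> DIM(real \<times> real)" by (rule dim_subset_UNIV)
  ultimately show False by simp
qed

context orthogonal_frame
begin

text \<open>The dimension is read off from the given basis \<open>e\<close>.\<close>

lemma card_le_of_independent:
  fixes T :: "(real ^ 'd) set"
  assumes "independent T"
  shows "card T \<le> n + 2" "card T = n + 2 \<longleftrightarrow> span T = UNIV"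
proof -
  have b: "inj_on e {1..n+2}" "independent (e ` {1..n+2})" "span (e ` {1..n+2}) = UNIV"
    using basis by (auto simp: orthogonal_basis_def)
  have "dim (span (e ` {1..n+2})) = card (e ` {1..n+2})"
    by (simp only: dim_span dim_eq_card_independent[OF b(2)])
  then have d: "dim (UNIV :: (real ^ 'd) set) = n + 2"
    unfolding b(3) card_image[OF b(1)] by simp
  have t: "dim (span T) = card T" using dim_eq_card_independent[OF assms] by simp
  show "card T \<le> n + 2"
    using dim_subset[OF subset_UNIV, of "span T"] t d by linarith
  show "card T = n + 2 \<longleftrightarrow> span T = UNIV"
    unfolding dim_eq_full[symmetric] using t d by simp
qed

lemma ext_coord: "ext Q v v = (\<Sum>j=1..n+2. sgn_e j * (ext Q v (e j))\<^sup>2)"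
  unfolding ext_real_expansion[of v v] by (simp only: power2_eq_square mult.assoc)

text \<open>
  Otherwise \<open>a\<close>, \<open>b\<close>, \<open>x\<close> span a 3-dimensional negative semidefinite space, which meets the
  positive definite span of \<open>e\<^sub>1, \<dots>, e\<^sub>n\<close> (of codimension 2) nontrivially.
\<close>

lemma positive_on_complement:
  fixes a b x :: "real ^ 'd"
  assumes a: "ext Q a a = -1" and b: "ext Q b b = -1" and ab: "ext Q a b = 0"
    and x: "ext Q x a = 0" "ext Q x b = 0" "x \<noteq> 0"
  shows "ext Q x x > 0"
proof (rule ccontr)
  assume nonpos: "\<not> ext Q x x > 0"
  define y where "y = (\<lambda>(p, q, r). p *\<^sub>R a + q *\<^sub>R b + r *\<^sub>R x)"
  define T where "T = (\<lambda>z. (ext Q (y z) (e (n+1)), ext Q (y z) (e (n+2))))"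
  have "linear T"
    unfolding T_def y_def
    by (auto intro!: linearI simp: ext_add_left ext_scaleR_left algebra_simps)
  \<comment> \<open>The kernel vector is a triple of coefficients, so independence of
    \<open>a\<close>, \<open>b\<close>, \<open>x\<close> is not presupposed; it is settled at the
    end by \<open>x \<noteq> 0\<close>.\<close>
  then obtain z where z: "z \<noteq> 0" "T z = 0" using exists_kernel_vector by blast
  obtain p q r where pqr: "z = (p, q, r)" by (cases z)
  define v where "v = p *\<^sub>R a + q *\<^sub>R b + r *\<^sub>R x"
  have v0: "ext Q v (e (n+1)) = 0" "ext Q v (e (n+2)) = 0"
    using z(2) by (auto simp: T_def y_def pqr v_def zero_prod_def)
  have vv: "ext Q v v = (\<Sum>j=1..n. (ext Q v (e j))\<^sup>2)"
    unfolding ext_coord[of v] sum_split_last_two v0 by (simp add: sgn_e_def)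
  then have "ext Q v v \<ge> 0" by (simp add: sum_nonneg)
  moreover have eq: "ext Q v v = - p\<^sup>2 - q\<^sup>2 + r\<^sup>2 * ext Q x x"
    using a b ab x ext_sym[OF Q_sym, of a b] ext_sym[OF Q_sym, of x a] ext_sym[OF Q_sym, of x b]
    by (simp add: v_def ext_add_left ext_add_right ext_scaleR_left ext_scaleR_right power2_eq_square algebra_simps)
  moreover have le: "r\<^sup>2 * ext Q x x \<le> 0" using nonpos by (simp add: mult_nonneg_nonpos)
  ultimately have sq: "p\<^sup>2 + q\<^sup>2 \<le> 0" by linarith
  then have pq: "p = 0" "q = 0" by (simp_all add: sum_power2_le_zero_iff)
  have "ext Q v v = 0" using \<open>ext Q v v \<ge> 0\<close> eq le pq by simp
  then have "\<forall>j\<in>{1..n}. (ext Q v (e j))\<^sup>2 = 0"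
    unfolding vv by (subst (asm) sum_nonneg_eq_0_iff) auto
  moreover have "{1..n+2} = insert (n + 2) (insert (n + 1) {1..n})" by auto
  ultimately have "\<forall>j\<in>{1..n+2}. ext Q v (e j) = ext Q 0 (e j)"
    using v0 by (simp add: ext_zero)
  then have "v = 0" using eq_iff_ext_basis[of v 0] by blast
  then have "r *\<^sub>R x = 0" by (simp add: v_def pq)
  then show False using x(3) z(1) by (simp add: pqr pq zero_prod_def)
qed

definition orthonormal_complement :: "real ^ 'd \<Rightarrow> real ^ 'd \<Rightarrow> (real ^ 'd) set \<Rightarrow> bool" where
  "orthonormal_complement a b S \<longleftrightarrow> finite S \<and>
     (\<forall>x\<in>S. ext Q x a = 0 \<and> ext Q x b = 0 \<and> ext Q x x = 1) \<and>
     (\<forall>x\<in>S. \<forall>y\<in>S. x \<noteq> y \<longrightarrow> ext Q x y = 0)"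

text \<open>Gram-Schmidt by maximality: if a largest \<open>S\<close> together with
  \<open>a\<close>, \<open>b\<close> failed to span, the orthogonal remainder of an outside vector
  would have positive square and, once normalised, enlarge \<open>S\<close>.\<close>

lemma exists_orthonormal_complement:
  fixes a b :: "real ^ 'd"
  assumes a: "ext Q a a = -1" and b: "ext Q b b = -1" and ab: "ext Q a b = 0"
  shows "\<exists>S. orthonormal_complement a b S \<and> card S = n \<and>
     independent (insert a (insert b S)) \<and> span (insert a (insert b S)) = UNIV"
proof -
  have ba: "ext Q b a = 0" using ab ext_sym[OF Q_sym] by metis
  have T: "independent (insert a (insert b S))" "card (insert a (insert b S)) = card S + 2"
    "finite (insert a (insert b S))"
    "\<And>x. x \<in> insert a (insert b S) \<Longrightarrow> ext Q x x \<noteq> 0"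
    "\<And>x y. x \<in> insert a (insert b S) \<Longrightarrow> y \<in> insert a (insert b S) \<Longrightarrow> x \<noteq> y \<Longrightarrow> ext Q x y = 0"
    if S: "orthonormal_complement a b S" for S
  proof -
    show fin: "finite (insert a (insert b S))" using S by (simp add: orthonormal_complement_def)
    show nz: "ext Q x x \<noteq> 0" if "x \<in> insert a (insert b S)" for x
      using S that a b by (auto simp: orthonormal_complement_def)
    show orth: "ext Q x y = 0" if "x \<in> insert a (insert b S)" "y \<in> insert a (insert b S)" "x \<noteq> y" for x y
      using S that ab ba ext_sym[OF Q_sym, of x y] by (auto simp: orthonormal_complement_def)
    show "independent (insert a (insert b S))"
      using fin nz orth by (rule independent_of_orthogonal)
    have "a \<noteq> b" using a ab by auto
    moreover have "a \<notin> S" "b \<notin> S" using S a b by (auto simp: orthonormal_complement_def)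
    ultimately show "card (insert a (insert b S)) = card S + 2" using fin by simp
  qed
  have "orthonormal_complement a b {}" by (simp add: orthonormal_complement_def)
  moreover have "card S < n + 1" if "orthonormal_complement a b S" for S
    using card_le_of_independent(1)[OF T(1)[OF that]] T(2)[OF that] by simp
  ultimately obtain S where S: "orthonormal_complement a b S"
    and mx: "\<And>S'. orthonormal_complement a b S' \<Longrightarrow> card S' \<le> card S"
    using ex_has_greatest_nat[of "orthonormal_complement a b" "{}" card "n + 1"] by blast
  define B where "B = insert a (insert b S)"
  note TB = T[OF S, folded B_def]
  have "span B = UNIV"
  proof (rule ccontr)
    assume "span B \<noteq> UNIV"
    then obtain x where x: "x \<notin> span B" by blast
    \<comment> \<open>The division by \<open>ext Q t t\<close> supplies the sign -1 for the negative
      vectors \<open>a\<close> and \<open>b\<close>.\<close>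
    define y where "y = x - (\<Sum>t\<in>B. (ext Q x t / ext Q t t) *\<^sub>R t)"
    have sp: "(\<Sum>t\<in>B. (ext Q x t / ext Q t t) *\<^sub>R t) \<in> span B"
      by (intro span_sum span_scale span_base)
    have yB: "y \<notin> span B"
    proof
      assume "y \<in> span B"
      then have "y + (\<Sum>t\<in>B. (ext Q x t / ext Q t t) *\<^sub>R t) \<in> span B" using sp by (rule span_add)
      then show False using x by (simp add: y_def)
    qed
    have yo: "ext Q y t = 0" if "t \<in> B" for t
    proof -
      have "ext Q (\<Sum>t\<in>B. (ext Q x t / ext Q t t) *\<^sub>R t) t = (\<Sum>s\<in>B. if s = t then ext Q x t else 0)"
        unfolding ext_sum_left ext_scaleR_left using that TB(4,5) by (intro sum.cong) auto
      also have "\<dots> = ext Q x t" using that TB(3) by simp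
      finally have s: "ext Q (\<Sum>t\<in>B. (ext Q x t / ext Q t t) *\<^sub>R t) t = ext Q x t" .
      have "ext Q x t = ext Q (y + (\<Sum>t\<in>B. (ext Q x t / ext Q t t) *\<^sub>R t)) t" by (simp add: y_def)
      then show ?thesis unfolding ext_add_left s by simp
    qed
    have "y \<noteq> 0" using yB span_zero by blast
    then have pos: "ext Q y y > 0"
      using positive_on_complement[OF a b ab] yo by (auto simp: B_def)
    define s where "s = (1 / sqrt (ext Q y y)) *\<^sub>R y"
    have so: "ext Q s t = 0" if "t \<in> B" for t using yo[OF that] by (simp add: s_def ext_scaleR_left)
    have s1: "ext Q s s = 1" using pos by (simp add: s_def ext_scaleR_left ext_scaleR_right)
    have "s \<notin> S" using so[of s] s1 by (auto simp: B_def)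
    moreover have "ext Q t s = 0" if "t \<in> B" for t
      using so[OF that] ext_sym[OF Q_sym, of t s] by simp
    then have "orthonormal_complement a b (insert s S)"
      using S so s1 by (auto simp: orthonormal_complement_def B_def)
    ultimately show False using mx[of "insert s S"] S by (auto simp: orthonormal_complement_def)
  qed
  then have "card S = n" using card_le_of_independent(2)[OF TB(1)] TB(2) by simp
  then show ?thesis using S TB(1) \<open>span B = UNIV\<close> unfolding B_def by blast
qed

text \<open>For u = a + i b, isotropy gives Q(a,a) = Q(b,b) and Q(a,b) = 0, while the hermitian
  value is Q(a,a) + Q(b,b); after rescaling, \<open>a\<close> and \<open>b\<close> serve as the two
  negative basis vectors.\<close>

lemma exists_adapted_basis:
  assumes "ext Q f f = 0" "Re (ext Q f (conjv f)) < 0"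
  shows "\<exists>e'. adapted_basis Q n (cline f) e'"
proof -
  \<comment> \<open>Scales the hermitian value to -2, as required of
    \<open>e (n+1) + \<i> e (n+2)\<close>.\<close>
  define r where "r = sqrt (2 / - Re (ext Q f (conjv f)))"
  have r: "r\<^sup>2 * Re (ext Q f (conjv f)) = -2" using assms(2) by (simp add: r_def)
  define u where "u = complex_of_real r *s f"
  define a where "a = re_vec u"
  define b where "b = im_vec u"
  have uab: "u = complexify a + \<i> *s complexify b" unfolding a_def b_def by (rule complexify_re_im)
  have cuab: "conjv u = complexify a + (- \<i>) *s complexify b"
    by (simp add: uab conjv_add conjv_scale)
  have "ext Q u u = 0" using assms(1) by (simp add: u_def ext_scale_left ext_scale_right)
  then have "complex_of_real (ext Q a a - ext Q b b) + \<i> * of_real (2 * ext Q a b) = 0"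
    using ext_sym[OF Q_sym, of b a]
    by (simp add: uab ext_add_left ext_add_right ext_scale_left ext_scale_right ext_complexify algebra_simps)
  then have 1: "ext Q a a = ext Q b b" "ext Q a b = 0" by (simp_all add: complex_eq_iff)
  have "Re (ext Q u (conjv u)) = -2"
    using r by (simp add: u_def ext_scale_left ext_scale_right conjv_scale power2_eq_square)
  then have "ext Q a a + ext Q b b = -2"
    using ext_sym[OF Q_sym, of b a]
    unfolding cuab unfolding uab ext_add_left ext_add_right ext_scale_left ext_scale_right ext_complexify by simp
  with 1 have ab: "ext Q a a = -1" "ext Q b b = -1" "ext Q a b = 0" "ext Q b a = 0"
    using ext_sym[OF Q_sym, of b a] by auto
  obtain S where S: "orthonormal_complement a b S" "card S = n"
    "independent (insert a (insert b S))" "span (insert a (insert b S)) = UNIV"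
    using exists_orthonormal_complement[OF ab(1-3)] by blast
  have S': "\<And>x. x \<in> S \<Longrightarrow> ext Q x a = 0" "\<And>x. x \<in> S \<Longrightarrow> ext Q x b = 0"
    "\<And>x. x \<in> S \<Longrightarrow> ext Q x x = 1" "\<And>x y. x \<in> S \<Longrightarrow> y \<in> S \<Longrightarrow> x \<noteq> y \<Longrightarrow> ext Q x y = 0"
    using S(1) unfolding orthonormal_complement_def by blast+
  have "finite S" using S(1) by (simp add: orthonormal_complement_def)
  then obtain h where h: "bij_betw h {1..n} S"
    using ex_bij_betw_nat_finite_1 S(2) by blast
  define e' where "e' j = (if j \<le> n then h j else if j = n + 1 then a else b)" for j
  have hS: "h j \<in> S" if "j \<in> {1..n}" for j using h that by (auto simp: bij_betw_def)
  have I: "{1..n+2} = insert (n + 1) (insert (n + 2) {1..n})" by auto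
  have img: "e' ` {1..n+2} = insert a (insert b S)"
  proof -
    have "e' ` {1..n} = h ` {1..n}" by (rule image_cong) (auto simp: e'_def)
    also have "\<dots> = S" using h by (simp add: bij_betw_def)
    finally show ?thesis unfolding I image_insert by (simp add: e'_def)
  qed
  have g: "ext Q (e' i) (e' j) = (if i = j then sgn_e j else 0)" if ij: "i \<in> {1..n+2}" "j \<in> {1..n+2}" for i j
  proof -
    have hh: "ext Q (h i) (h j) = (if i = j then 1 else 0)" if "i \<in> {1..n}" "j \<in> {1..n}" for i j
    proof (cases "i = j")
      case False
      then have "h i \<noteq> h j"
        using bij_betw_imp_inj_on[OF h] that by (simp add: inj_on_eq_iff)
      then show ?thesis using False S'(4)[OF hS[OF that(1)] hS[OF that(2)]] by simp
    qed (simp add: S'(3)[OF hS[OF that(2)]])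
    have ha: "ext Q (h i) a = 0" "ext Q (h i) b = 0" "ext Q a (h i) = 0" "ext Q b (h i) = 0"
      if "i \<in> {1..n}" for i
      using S'(1,2)[OF hS[OF that]] ext_sym[OF Q_sym, of a "h i"] ext_sym[OF Q_sym, of b "h i"]
      by simp_all
    have "i \<in> {1..n} \<or> i = n + 1 \<or> i = n + 2" "j \<in> {1..n} \<or> j = n + 1 \<or> j = n + 2"
      using ij unfolding I by blast+
    then show ?thesis by (elim disjE) (simp_all add: hh ha ab e'_def sgn_e_def)
  qed
  \<comment> \<open>Equal vectors at distinct indices would make a diagonal entry of the Gram
    matrix, which is 1 or -1, equal to an off-diagonal 0.\<close>
  have "inj_on e' {1..n+2}"
  proof (rule inj_onI, rule ccontr)
    fix i j assume ij: "i \<in> {1..n+2}" "j \<in> {1..n+2}" "e' i = e' j" "i \<noteq> j"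
    have "ext Q (e' i) (e' j) = 0" "ext Q (e' j) (e' j) = sgn_e j"
      using g[OF ij(1,2)] g[OF ij(2,2)] ij(4) by simp_all
    then show False using ij(3) by (simp add: sgn_e_def split: if_splits)
  qed
  then have "orthogonal_basis Q n e'"
    unfolding orthogonal_basis_def img using S(3,4) by (simp add: g sgn_e_def)
  moreover have "complexify (e' (n+1)) + \<i> *s complexify (e' (n+2)) = u"
    by (simp add: e'_def uab)
  moreover have "u \<in> cline f" unfolding u_def cline_def by blast
  ultimately show ?thesis unfolding adapted_basis_def by auto
qed

end

section \<open>Both forms as polynomials in the components of the differential of \<sigma>\<close>

section \<open>Comparison with the Kudla-Millson form\<close>

definition homogeneous :: "nat \<Rightarrow> 't form \<Rightarrow> bool" where
  "homogeneous p \<alpha> \<longleftrightarrow> (\<forall>ts. length ts \<noteq> p \<longrightarrow> \<alpha> ts = 0)"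

lemma homogeneous_wedge:
  assumes "homogeneous p \<alpha>" "homogeneous q \<beta>"
  shows "homogeneous (p + q) (wedge \<alpha> \<beta>)"
  unfolding homogeneous_def
proof (intro allI impI)
  fix ts :: "'a list" assume l: "length ts \<noteq> p + q"
  show "wedge \<alpha> \<beta> ts = 0"
    unfolding wedge_def
  proof (intro sum.neutral ballI)
    fix I assume "I \<in> Pow {..<length ts}"
    then have I: "I \<subseteq> {..<length ts}" by simp
    have "card I \<noteq> p \<or> length ts - card I \<noteq> q" using l length_nths_compl(2)[OF I] by arith
    then have "\<alpha> (nths ts I) = 0 \<or> \<beta> (nths ts ({..<length ts} - I)) = 0"
      using assms length_nths_subset[OF I] length_nths_compl[OF I] unfolding homogeneous_def by metis
    then show "shuffle_sign (length ts) I * \<alpha> (nths ts I) * \<beta> (nths ts ({..<length ts} - I)) = 0"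
      by auto
  qed
qed

lemma homogeneous_omega: "homogeneous 1 (omega e \<sigma> w \<alpha> \<mu>)"
  by (auto simp: homogeneous_def omega_def one_form_def split: list.split)

text \<open>Homogeneity is assumed at every \<open>v\<close>, so on lists of the wrong length the
  differentiated function is identically 0.\<close>

lemma homogeneous_howe_op:
  assumes "\<And>v. homogeneous p (F v)"
  shows "homogeneous (Suc p) (howe_op e \<sigma> w \<mu> F v)"
proof -
  define G where "G \<alpha> = (\<lambda>ts'. of_real (basis_coord CARD('b) e \<alpha> v) * F v ts'
        - of_real (1 / (2 * pi)) * frechet_derivative (\<lambda>v'. F v' ts') (at v) (e \<alpha>))" for \<alpha>
  have "homogeneous p (G \<alpha>)" for \<alpha>
    using assms by (simp add: homogeneous_def G_def)
  from homogeneous_wedge[OF homogeneous_omega this]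
  have "homogeneous (Suc p) (wedge (omega e \<sigma> w \<alpha> \<mu>) (G \<alpha>))" for \<alpha> by simp
  then show ?thesis
    unfolding howe_op_def G_def[symmetric] by (simp add: homogeneous_def)
qed

lemma homogeneous_phi_KM_basis: "homogeneous 2 (phi_KM_basis e \<sigma> w v)"
proof -
  have "homogeneous 0 (zero_form c)" for c by (simp add: homogeneous_def zero_form_def)
  from homogeneous_howe_op[OF homogeneous_howe_op[OF this]] show ?thesis
    by (simp add: phi_KM_basis_def homogeneous_def numeral_2_eq_2)
qed

text \<open>The scalar \<open>c\<close> carries the frame vector to the adapted isotropic vector; it
  measures the freedom in the frame and cancels from the final formulas.\<close>

locale adapted_framed_chart = framed_period_chart Q U \<sigma>
  for Q :: "rat ^ 'd \<Rightarrow> rat ^ 'd \<Rightarrow> rat" and U :: "(complex ^ 'n) set" and \<sigma> +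
  fixes w :: "complex ^ 'n" and e :: "nat \<Rightarrow> real ^ 'd" and c :: complex and n :: nat
  assumes n_eq: "CARD('n) = n"
    and w: "w \<in> U"
    and e_basis: "orthogonal_basis Q n e"
    and e_adapted: "complexify (e (n + 1)) + \<i> *s complexify (e (n + 2)) = c *s \<sigma> w"
begin

sublocale orthogonal_frame Q n e
  by unfold_locales (rule Q_sym e_basis)+

abbreviation E :: "nat \<Rightarrow> complex ^ 'd" where "E j \<equiv> complexify (e j)"

abbreviation x :: "nat \<Rightarrow> real ^ 'd \<Rightarrow> real" where "x \<equiv> basis_coord n e"

lemma ext_c\<sigma>_E:
  assumes "j \<in> {1..n+2}"
  shows "c * ext Q (\<sigma> w) (E j) = (if j = n + 1 then -1 else if j = n + 2 then -\<i> else 0)"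
proof -
  have "c * ext Q (\<sigma> w) (E j) = ext Q (E (n + 1)) (E j) + \<i> * ext Q (E (n + 2)) (E j)"
    unfolding ext_scale_left[symmetric] e_adapted[symmetric] ext_add_left ..
  also have "\<dots> = (if j = n + 1 then -1 else if j = n + 2 then -\<i> else 0)"
    using assms by (simp add: ext_complexify ext_basis sgn_e_def)
  finally show ?thesis .
qed

lemma c_nonzero: "c \<noteq> 0"
  using ext_c\<sigma>_E[of "n + 1"] by auto

lemma ext_\<sigma>_E:
  "\<alpha> \<in> {1..n} \<Longrightarrow> ext Q (\<sigma> w) (E \<alpha>) = 0"
  "ext Q (\<sigma> w) (E (n + 1)) = - (1 / c)"
  "ext Q (\<sigma> w) (E (n + 2)) = - (\<i> / c)"
  using ext_c\<sigma>_E[of \<alpha>] ext_c\<sigma>_E[of "n + 1"] ext_c\<sigma>_E[of "n + 2"] c_nonzero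
  by (auto simp: field_simps)

lemma norm_sq_eq: "norm_sq w = - 2 / (c * cnj c)"
proof -
  have "norm_sq w = (\<Sum>j=1..n+2. of_real (sgn_e j) * ext Q (\<sigma> w) (E j) * cnj (ext Q (\<sigma> w) (E j)))"
    unfolding norm_sq_def ext_conjv_expansion ..
  also have "\<dots> = - 2 / (c * cnj c)"
    unfolding sum_split_last_two ext_\<sigma>_E(2,3)
    by (simp add: ext_\<sigma>_E(1) sgn_e_def)
  finally show ?thesis .
qed

text \<open>Tangency to the cone gives \<open>X1 + \<i> * X2 = 0\<close>, and the definition of
  \<open>conn\<close> gives \<open>X1 - \<i> * X2\<close>; so the negative components of the
  differential are exactly the connection form.\<close>

lemma ext_d\<sigma>_E:
  "ext Q (d\<sigma> w t) (E (n + 1)) = - conn w t / c"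
  "ext Q (d\<sigma> w t) (E (n + 2)) = - \<i> * conn w t / c"
proof -
  define X1 X2 where "X1 = ext Q (d\<sigma> w t) (E (n + 1))" and "X2 = ext Q (d\<sigma> w t) (E (n + 2))"
  have "X1 + \<i> * X2 = ext Q (d\<sigma> w t) (c *s \<sigma> w)"
    unfolding e_adapted[symmetric] X1_def X2_def ext_add_right ext_scale_right ..
  also have "\<dots> = 0" by (simp add: ext_scale_right ext_d\<sigma>_\<sigma>[OF w])
  finally have s: "X1 + \<i> * X2 = 0" .
  have "cnj c * (conn w t * norm_sq w) = ext Q (d\<sigma> w t) (conjv (c *s \<sigma> w))"
    using norm_sq_nonzero[OF w] by (simp add: conn_def conjv_scale ext_scale_right)
  also have "\<dots> = X1 - \<i> * X2"
    unfolding e_adapted[symmetric] X1_def X2_def conjv_add conjv_scale conjv_complexify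
      ext_add_right ext_scale_right by simp
  finally have d: "X1 - \<i> * X2 = - 2 * conn w t / c"
    using c_nonzero by (simp add: norm_sq_eq field_simps)
  have "X1 = ((X1 + \<i> * X2) + (X1 - \<i> * X2)) / 2" by simp
  then have "X1 = - conn w t / c" unfolding s d by simp
  moreover have "X2 = \<i> * X1" using s by (simp add: complex_eq_iff)
  ultimately show "ext Q (d\<sigma> w t) (E (n + 1)) = - conn w t / c"
    "ext Q (d\<sigma> w t) (E (n + 2)) = - \<i> * conn w t / c"
    by (simp_all add: X1_def X2_def)
qed

text \<open>The value on \<open>t\<close> of \<open>\<omega>\<^bsub>\<alpha>,n+1\<^esub> + i \<omega>\<^bsub>\<alpha>,n+2\<^esub>\<close>; see \<open>omega_eq\<close>.\<close>

definition p :: "nat \<Rightarrow> complex ^ 'n \<Rightarrow> complex" where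
  "p \<alpha> t = c * ext Q (d\<sigma> w t) (E \<alpha>)"

lemma ext_d\<sigma>_E_p: "ext Q (d\<sigma> w t) (E \<alpha>) = p \<alpha> t / c"
  using c_nonzero by (simp add: p_def)

lemma s_coeff_eq: "s_coeff v w = - (of_real (x (n + 1) v) + \<i> * of_real (x (n + 2) v)) / c"
  unfolding s_map_def ext_complexify_expansion[of _ v] sum_split_last_two ext_\<sigma>_E(2,3)
  using c_nonzero by (simp add: ext_\<sigma>_E(1) field_simps)

text \<open>The connection term cancels the components along the negative plane, leaving the
  positive coordinates of \<open>v\<close>.\<close>

lemma ds_cov_eq: "ds_cov v w t = (\<Sum>\<alpha>=1..n. of_real (x \<alpha> v) * p \<alpha> t) / c"
  unfolding ds_cov_def s_coeff_eq unfolding s_map_def ext_complexify_expansion[of _ v]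
    sum_split_last_two ext_d\<sigma>_E
  by (simp add: ext_d\<sigma>_E_p sum_divide_distrib) (simp add: algebra_simps add_divide_distrib diff_divide_distrib)

text \<open>By the same cancellation the negative plane contributes exactly
  \<open>conn w u * cnj (conn w t)\<close>, and only the positive directions remain.\<close>

lemma curvature_conn_eq:
  "ext Q (d\<sigma> w u) (conjv (d\<sigma> w t)) / norm_sq w - conn w u * cnj (conn w t) =
    - (\<Sum>\<alpha>=1..n. p \<alpha> u * cnj (p \<alpha> t)) / 2"
proof -
  have s: "(\<Sum>\<alpha>=1..n. of_real (sgn_e \<alpha>) * ext Q (d\<sigma> w u) (E \<alpha>) * cnj (ext Q (d\<sigma> w t) (E \<alpha>))) =
      (\<Sum>\<alpha>=1..n. p \<alpha> u * cnj (p \<alpha> t)) / (c * cnj c)"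
    unfolding sum_divide_distrib by (intro sum.cong) (auto simp: ext_d\<sigma>_E_p sgn_e_def)
  have "ext Q (d\<sigma> w u) (conjv (d\<sigma> w t)) =
      ((\<Sum>\<alpha>=1..n. p \<alpha> u * cnj (p \<alpha> t)) - 2 * conn w u * cnj (conn w t)) / (c * cnj c)"
    unfolding ext_conjv_expansion[of "d\<sigma> w u"] sum_split_last_two s ext_d\<sigma>_E
    by (simp add: sgn_e_def diff_divide_distrib algebra_simps)
  then show ?thesis
    unfolding norm_sq_eq using c_nonzero by (simp add: field_simps)
qed

text \<open>The scalar part of the curvature contributes -2\<pi> times the sum of squares of the two
  negative coordinates, which reverses their sign in -\<pi> Q(v,v) and yields the positive definite
  majorant.\<close>

lemma exponent_eq:
  "exp (of_real (- pi * ext Q v v) + 4 * of_real pi * (s_coeff v w * cnj (s_coeff v w)) / norm_sq w) =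
    of_real (gaussian n e v)"
proof -
  have q: "ext Q v v = (\<Sum>j=1..n. (x j v)\<^sup>2) - (x (n + 1) v)\<^sup>2 - (x (n + 2) v)\<^sup>2"
  proof -
    have "ext Q v v = (\<Sum>j=1..n+2. sgn_e j * (x j v)\<^sup>2)"
      unfolding ext_real_expansion[of v v]
      by (intro sum.cong) (auto simp: basis_coord_eq sgn_e_def power2_eq_square)
    then show ?thesis unfolding sum_split_last_two by (simp add: sgn_e_def)
  qed
  have "s_coeff v w * cnj (s_coeff v w) = of_real ((x (n + 1) v)\<^sup>2 + (x (n + 2) v)\<^sup>2) / (c * cnj c)"
    unfolding s_coeff_eq by (simp add: power2_eq_square algebra_simps complex_eq_iff)
  note S = this
  have "4 * of_real pi * (s_coeff v w * cnj (s_coeff v w)) / norm_sq w =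
      of_real (- 2 * pi * ((x (n + 1) v)\<^sup>2 + (x (n + 2) v)\<^sup>2))"
    unfolding norm_sq_eq S using c_nonzero by (simp add: field_simps)
  then have "of_real (- pi * ext Q v v) + 4 * of_real pi * (s_coeff v w * cnj (s_coeff v w)) / norm_sq w =
      complex_of_real (- pi * (\<Sum>j=1..n+2. (x j v)\<^sup>2))"
    unfolding q sum_split_last_two of_real_add[symmetric] by (simp add: algebra_simps)
  then show ?thesis by (simp only: gaussian_def exp_of_real)
qed

text \<open>The contraction \<open>\<Sum>\<^sub>\<alpha> x\<^sub>\<alpha>(v) \<omega>\<^bsub>\<alpha>\<mu>\<^esub>\<close>, for \<open>\<mu> = n+1\<close> (real part) and \<open>\<mu> = n+2\<close> (imaginary part).\<close>

definition xRe :: "real ^ 'd \<Rightarrow> complex ^ 'n \<Rightarrow> real" where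
  "xRe v t = (\<Sum>\<alpha>=1..n. x \<alpha> v * Re (p \<alpha> t))"

definition xIm :: "real ^ 'd \<Rightarrow> complex ^ 'n \<Rightarrow> real" where
  "xIm v t = (\<Sum>\<alpha>=1..n. x \<alpha> v * Im (p \<alpha> t))"

text \<open>The value on \<open>t\<close>, \<open>u\<close> of the sum over \<alpha> of the wedge
  products of the two one-forms \<omega> of index \<alpha>.\<close>

definition omega_area :: "complex ^ 'n \<Rightarrow> complex ^ 'n \<Rightarrow> real" where
  "omega_area t u = (\<Sum>\<alpha>=1..n. Re (p \<alpha> t) * Im (p \<alpha> u) - Re (p \<alpha> u) * Im (p \<alpha> t))"

lemma sum_x_p: "(\<Sum>\<alpha>=1..n. of_real (x \<alpha> v) * p \<alpha> t) = Complex (xRe v t) (xIm v t)"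
  by (simp add: complex_eq_iff xRe_def xIm_def)

text \<open>The curvature of L gives \<open>omega_area\<close> and the covariant derivatives give
  the quadratic term; both are imaginary, and the common factor -2\<pi>i cancels against the star
  operator.\<close>

lemma star_phi_pair:
  "inverse (- 2 * of_real pi * \<i>) * phi Q \<sigma> v w [t, u] =
    of_real (gaussian n e v * (2 * (xRe v t * xIm v u - xRe v u * xIm v t) - omega_area t u / (2 * pi)))"
proof -
  have "(ext Q (d\<sigma> w u) (conjv (d\<sigma> w t)) - ext Q (d\<sigma> w t) (conjv (d\<sigma> w u))) / norm_sq w
       - (conn w u * cnj (conn w t) - conn w t * cnj (conn w u)) =
       - ((\<Sum>\<alpha>=1..n. p \<alpha> u * cnj (p \<alpha> t)) - (\<Sum>\<alpha>=1..n. p \<alpha> t * cnj (p \<alpha> u))) / 2"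
    (is "?K = _")
  proof -
    have "?K = (ext Q (d\<sigma> w u) (conjv (d\<sigma> w t)) / norm_sq w - conn w u * cnj (conn w t)) -
        (ext Q (d\<sigma> w t) (conjv (d\<sigma> w u)) / norm_sq w - conn w t * cnj (conn w u))"
      by (simp add: diff_divide_distrib)
    then show ?thesis unfolding curvature_conn_eq by (simp add: diff_divide_distrib)
  qed
  also have "\<dots> = - \<i> * of_real (omega_area t u)"
    unfolding sum_subtractf[symmetric]
    by (auto simp: complex_eq_iff omega_area_def algebra_simps sum_subtractf diff_divide_distrib
        simp flip: sum_negf intro!: sum.cong)
  finally have 1: "(ext Q (d\<sigma> w u) (conjv (d\<sigma> w t)) - ext Q (d\<sigma> w t) (conjv (d\<sigma> w u))) / norm_sq w
       - (conn w u * cnj (conn w t) - conn w t * cnj (conn w u)) = - \<i> * of_real (omega_area t u)" .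
  define A where "A = xRe v t * xIm v u - xRe v u * xIm v t"
  have A: "Complex (xRe v t) (xIm v t) * cnj (Complex (xRe v u) (xIm v u)) -
      Complex (xRe v u) (xIm v u) * cnj (Complex (xRe v t) (xIm v t)) = - 2 * \<i> * of_real A"
    by (simp add: A_def complex_eq_iff algebra_simps)
  have "ds_cov v w t * cnj (ds_cov v w u) - ds_cov v w u * cnj (ds_cov v w t) =
     - 2 * \<i> * of_real A / (c * cnj c)"
    unfolding ds_cov_eq sum_x_p complex_cnj_divide times_divide_times_eq
      diff_divide_distrib[symmetric] A ..
  note ds = this
  have 2: "4 * of_real pi * (ds_cov v w t * cnj (ds_cov v w u) - ds_cov v w u * cnj (ds_cov v w t)) / norm_sq w
      = 4 * of_real pi * \<i> * of_real A"
    unfolding norm_sq_eq ds using c_nonzero by (simp add: field_simps)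
  have "phi Q \<sigma> v w [t, u] =
      - 2 * of_real pi * \<i> * of_real (gaussian n e v * (2 * A - omega_area t u / (2 * pi)))"
    unfolding phi_low_degree(2)[OF w] exponent_eq 1 2 by (simp add: algebra_simps)
  note phi = this
  have cancel: "inverse k * (k * y) = y" if "k \<noteq> 0" for k y :: complex
    using that by simp
  have "- 2 * complex_of_real pi * \<i> \<noteq> 0" by simp
  then show ?thesis unfolding phi A_def[symmetric] by (rule cancel)
qed

section \<open>The one-forms \<omega> at the base point\<close>

lemma neg_det_\<sigma>: "neg_det (\<sigma> w) = - 1 / (cmod c)\<^sup>2"
proof -
  have "ext Q (\<sigma> w) (E (n + 1)) * cnj (ext Q (\<sigma> w) (E (n + 2))) = - \<i> / of_real ((cmod c)\<^sup>2)"
    unfolding ext_\<sigma>_E complex_norm_square by simp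
  then show ?thesis unfolding neg_det_def by (simp del: of_real_power)
qed

text \<open>At the base point the real part of \<open>c *s \<sigma> w\<close> is
  \<open>e (n+1)\<close>, and multiplication by \<open>- \<i>\<close> turns it into
  \<open>e (n+2)\<close>.\<close>

lemma plane_coeff_\<sigma>: "plane_coeff (n + 1) (\<sigma> w) = c" "plane_coeff (n + 2) (\<sigma> w) = - \<i> * c"
proof -
  have d: "complex_of_real (neg_det (\<sigma> w)) = - 1 / (c * cnj c)"
    unfolding neg_det_\<sigma> by (simp add: complex_norm_square[symmetric])
  show "plane_coeff (n + 1) (\<sigma> w) = c" "plane_coeff (n + 2) (\<sigma> w) = - \<i> * c"
    unfolding plane_coeff_def d ext_\<sigma>_E using c_nonzero by (simp_all add: field_simps)
qed

lemma has_derivative_ext_\<sigma>_E: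
  assumes "w' \<in> U"
  shows "((\<lambda>w. ext Q (\<sigma> w) (E j)) has_derivative (\<lambda>t. ext Q (d\<sigma> w' t) (E j))) (at w')"
  by (rule has_derivative_eq_rhs[OF has_derivative_ext[OF has_derivative_\<sigma>[OF assms] has_derivative_const]])
    (simp add: ext_zero)

lemma differentiable_neg_det:
  assumes "w' \<in> U"
  shows "(\<lambda>w. neg_det (\<sigma> w)) differentiable (at w')"
  unfolding neg_det_def differentiable_def
  by (rule exI, rule bounded_linear.has_derivative[OF bounded_linear_Im], rule has_derivative_mult,
      rule has_derivative_ext_\<sigma>_E[OF assms], rule bounded_linear.has_derivative[OF bounded_linear_cnj],
      rule has_derivative_ext_\<sigma>_E[OF assms])

text \<open>Existence of the derivative suffices: in \<open>frechet_derivative_xi\<close> it is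
  multiplied by 0.\<close>

lemma differentiable_plane_coeff: "(\<lambda>w. plane_coeff \<mu> (\<sigma> w)) differentiable (at w)"
proof -
  have 1: "(\<lambda>w. cnj (ext Q (\<sigma> w) (E j))) differentiable (at w)" for j
    unfolding differentiable_def
    by (rule exI, rule bounded_linear.has_derivative[OF bounded_linear_cnj], rule has_derivative_ext_\<sigma>_E[OF w])
  obtain D where "((\<lambda>w. neg_det (\<sigma> w)) has_derivative D) (at w)"
    using differentiable_neg_det[OF w] by (auto simp: differentiable_def)
  then have "((\<lambda>w. complex_of_real (neg_det (\<sigma> w))) has_derivative (\<lambda>t. of_real (D t))) (at w)"
    by (rule bounded_linear.has_derivative[OF bounded_linear_of_real])
  then have 2: "(\<lambda>w. complex_of_real (neg_det (\<sigma> w))) differentiable (at w)"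
    by (auto simp: differentiable_def)
  have "complex_of_real (neg_det (\<sigma> w)) \<noteq> 0" using c_nonzero by (simp add: neg_det_\<sigma>)
  then show ?thesis
    unfolding plane_coeff_def
    by (cases "\<mu> = n + 1") (simp_all add: 1 2 differentiable_divide differentiable_mult)
qed

text \<open>In the product rule the term with the derivative of \<open>plane_coeff\<close> drops
  out, because \<open>ext Q (\<sigma> w) (E \<alpha>) = 0\<close>.\<close>

lemma frechet_derivative_xi:
  assumes "\<alpha> \<in> {1..n}" "\<mu> \<in> {n+1..n+2}"
  shows "frechet_derivative (\<lambda>w'. xi_coord n e \<alpha> \<mu> (cline (\<sigma> w'))) (at w) =
    (\<lambda>t. Re (plane_coeff \<mu> (\<sigma> w) * ext Q (d\<sigma> w t) (E \<alpha>)))"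
proof -
  \<comment> \<open>The neighbourhood of \<open>w\<close> on which the explicit formula for
    \<open>xi_coord\<close> is valid.\<close>
  define U' where "U' = U \<inter> (\<lambda>w. neg_det (\<sigma> w)) -` (- {0})"
  have "continuous_on U (\<lambda>w. neg_det (\<sigma> w))"
    using differentiable_neg_det differentiable_imp_continuous_within
    by (auto simp: continuous_on_eq_continuous_at[OF open_U])
  then have U': "open U'" unfolding U'_def by (rule continuous_open_preimage) (auto simp: open_U)
  have wU': "w \<in> U'" using w c_nonzero by (simp add: U'_def neg_det_\<sigma>)
  obtain K where K: "((\<lambda>w. plane_coeff \<mu> (\<sigma> w)) has_derivative K) (at w)"
    using differentiable_plane_coeff by (auto simp: differentiable_def)
  have "((\<lambda>w. Re (plane_coeff \<mu> (\<sigma> w) * ext Q (\<sigma> w) (E \<alpha>))) has_derivative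
      (\<lambda>t. Re (plane_coeff \<mu> (\<sigma> w) * ext Q (d\<sigma> w t) (E \<alpha>)))) (at w)"
    by (rule has_derivative_eq_rhs[OF bounded_linear.has_derivative[OF bounded_linear_Re
          has_derivative_mult[OF K has_derivative_ext_\<sigma>_E[OF w]]]])
      (simp add: ext_\<sigma>_E(1)[OF assms(1)])
  from frechet_derivative_at[OF this, symmetric] show ?thesis
  proof (subst frechet_derivative_cong_open[OF U' wU', where
          g = "\<lambda>w. Re (plane_coeff \<mu> (\<sigma> w) * ext Q (\<sigma> w) (E \<alpha>))"])
    fix w' assume "w' \<in> U'"
    then show "xi_coord n e \<alpha> \<mu> (cline (\<sigma> w')) = Re (plane_coeff \<mu> (\<sigma> w') * ext Q (\<sigma> w') (E \<alpha>))"
      by (intro xi_coord_cline[OF _ assms(2,1)]) (simp add: U'_def)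
  qed
qed

lemma omega_eq:
  assumes "\<alpha> \<in> {1..n}"
  shows "omega e \<sigma> w \<alpha> (n + 1) = one_form (\<lambda>t. of_real (Re (p \<alpha> t)))"
    "omega e \<sigma> w \<alpha> (n + 2) = one_form (\<lambda>t. of_real (Im (p \<alpha> t)))"
proof -
  show "omega e \<sigma> w \<alpha> (n + 1) = one_form (\<lambda>t. of_real (Re (p \<alpha> t)))"
    unfolding omega_def n_eq
    by (subst frechet_derivative_xi[OF assms]) (simp_all only: plane_coeff_\<sigma> p_def, auto)
  show "omega e \<sigma> w \<alpha> (n + 2) = one_form (\<lambda>t. of_real (Im (p \<alpha> t)))"
    unfolding omega_def n_eq
    by (subst frechet_derivative_xi[OF assms]) (simp_all only: plane_coeff_\<sigma> p_def, auto)
qed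

lemma wedge_one_form_short:
  "wedge (one_form f) \<beta> [u] = f u * \<beta> []"
  "wedge (one_form f) \<beta> [t, u] = f t * \<beta> [u] - f u * \<beta> [t]"
  by (simp_all add: wedge_single wedge_pair one_form_def)

lemma frechet_derivative_gaussian_e:
  assumes "\<alpha> \<in> {1..n}"
  shows "frechet_derivative (\<lambda>v. of_real (gaussian n e v) :: complex) (at v) (e \<alpha>) =
    of_real (- 2 * pi * gaussian n e v * x \<alpha> v)"
proof -
  note D = bounded_linear.has_derivative[OF bounded_linear_of_real has_derivative_gaussian[of v]]
  show ?thesis
    unfolding frechet_derivative_at[OF D, symmetric] sum_basis_coord_mult[OF assms] ..
qed

text \<open>Multiplication by a coordinate and the derivative term contribute equally on the
  Gaussian, hence the factor 2.\<close>

lemma howe_op_gaussian: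
  "howe_op e \<sigma> w (n + 2) (\<lambda>v'. zero_form (of_real (gaussian n e v'))) v [u] =
    of_real (2 * (gaussian n e v * xIm v u))"
proof -
  have "howe_op e \<sigma> w (n + 2) (\<lambda>v'. zero_form (of_real (gaussian n e v'))) v [u] =
    (\<Sum>\<alpha>=1..n. of_real (Im (p \<alpha> u) * (2 * x \<alpha> v * gaussian n e v)))"
    unfolding howe_op_def n_eq
  proof (intro sum.cong refl)
    fix \<alpha> assume a: "\<alpha> \<in> {1..n}"
    show "wedge (omega e \<sigma> w \<alpha> (n + 2))
          (\<lambda>ts'. of_real (x \<alpha> v) * zero_form (of_real (gaussian n e v)) ts' -
             of_real (1 / (2 * pi)) * frechet_derivative
               (\<lambda>v'. zero_form (of_real (gaussian n e v')) ts') (at v) (e \<alpha>)) [u] =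
       of_real (Im (p \<alpha> u) * (2 * x \<alpha> v * gaussian n e v))"
      unfolding omega_eq(2)[OF a] wedge_one_form_short
      by (simp add: zero_form_def frechet_derivative_gaussian_e[OF a])
  qed
  also have "\<dots> = of_real (2 * (gaussian n e v * xIm v u))"
    by (simp add: xIm_def sum_distrib_left mult_ac)
  finally show ?thesis .
qed

lemma frechet_derivative_gaussian_xIm:
  assumes "\<alpha> \<in> {1..n}"
  shows "frechet_derivative (\<lambda>v. of_real (2 * (gaussian n e v * xIm v u)) :: complex) (at v) (e \<alpha>) =
    of_real (2 * (gaussian n e v * Im (p \<alpha> u) - 2 * pi * gaussian n e v * x \<alpha> v * xIm v u))"
proof -
  have "((\<lambda>v. xIm v u) has_derivative (\<lambda>t. xIm t u)) (at v)"
    unfolding xIm_def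
    by (intro has_derivative_sum has_derivative_mult_left has_derivative_basis_coord) auto
  note D = bounded_linear.has_derivative[OF bounded_linear_of_real
      has_derivative_mult_right[OF has_derivative_mult[OF has_derivative_gaussian[of v] this], of 2]]
  have "xIm (e \<alpha>) u = (\<Sum>\<beta>=1..n. if \<beta> = \<alpha> then Im (p \<alpha> u) else 0)"
    unfolding xIm_def using assms by (intro sum.cong) (auto simp: basis_coord_basis)
  also have "\<dots> = Im (p \<alpha> u)" using assms by simp
  finally have "xIm (e \<alpha>) u = Im (p \<alpha> u)" .
  then show ?thesis
    unfolding frechet_derivative_at[OF D, symmetric] sum_basis_coord_mult[OF assms]
    by (simp add: algebra_simps)
qed

lemma phi_KM_basis_pair:
  "phi_KM_basis e \<sigma> w v [t, u] =
    of_real (gaussian n e v * (2 * (xRe v t * xIm v u - xRe v u * xIm v t) - omega_area t u / (2 * pi)))"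
proof -
  define g where "g = gaussian n e v"
  define F where "F = howe_op e \<sigma> w (n + 2) (\<lambda>v'. zero_form (of_real (gaussian n e v')))"
  have F: "F v [u] = of_real (2 * (gaussian n e v * xIm v u))" for v u
    unfolding F_def by (rule howe_op_gaussian)
  \<comment> \<open>Differentiating the Gaussian doubles the quadratic term again; differentiating
    the linear factor \<open>xIm\<close> produces the term that becomes
    \<open>omega_area\<close>.\<close>
  have G: "of_real (x \<alpha> v) * F v [u] - of_real (1 / (2 * pi)) * frechet_derivative (\<lambda>v'. F v' [u]) (at v) (e \<alpha>) =
      of_real (4 * g * xIm v u * x \<alpha> v - g * Im (p \<alpha> u) / pi)" if "\<alpha> \<in> {1..n}" for \<alpha> u
    unfolding F frechet_derivative_gaussian_xIm[OF that] g_def[symmetric]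
      of_real_mult[symmetric] of_real_diff[symmetric] of_real_eq_iff
    by (simp add: field_simps)
  have "howe_op e \<sigma> w (n + 1) F v [t, u] =
     (\<Sum>\<alpha>=1..n. of_real (Re (p \<alpha> t) * (4 * g * xIm v u * x \<alpha> v - g * Im (p \<alpha> u) / pi) -
        Re (p \<alpha> u) * (4 * g * xIm v t * x \<alpha> v - g * Im (p \<alpha> t) / pi)))"
    unfolding howe_op_def n_eq
    by (intro sum.cong refl) (simp only: omega_eq(1) wedge_one_form_short G of_real_mult of_real_diff)
  also have "\<dots> = of_real (\<Sum>\<alpha>=1..n. 4 * g * xIm v u * (x \<alpha> v * Re (p \<alpha> t)) - 4 * g * xIm v t * (x \<alpha> v * Re (p \<alpha> u)) -
        g / pi * (Re (p \<alpha> t) * Im (p \<alpha> u) - Re (p \<alpha> u) * Im (p \<alpha> t)))"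
    unfolding of_real_sum by (intro sum.cong refl arg_cong[of _ _ of_real]) (simp add: field_simps)
  also have "\<dots> = of_real (4 * g * xIm v u * xRe v t - 4 * g * xIm v t * xRe v u - g / pi * omega_area t u)"
    by (simp only: sum_subtractf sum_distrib_left[symmetric] xRe_def omega_area_def)
  finally have "howe_op e \<sigma> w (n + 1) F v [t, u] =
    of_real (4 * g * xIm v u * xRe v t - 4 * g * xIm v t * xRe v u - g / pi * omega_area t u)" .
  also have "\<dots> = 2 * complex_of_real (g * (2 * (xRe v t * xIm v u - xRe v u * xIm v t) - omega_area t u / (2 * pi)))"
    by (simp add: algebra_simps)
  finally show ?thesis
    unfolding phi_KM_basis_def n_eq F_def[symmetric] g_def[symmetric] by simp
qed

lemma star_phi_eq_phi_KM_basis: "deg_part 2 (star_op (phi Q \<sigma> v w)) = phi_KM_basis e \<sigma> w v"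
proof
  fix ts :: "(complex ^ 'n) list"
  show "deg_part 2 (star_op (phi Q \<sigma> v w)) ts = phi_KM_basis e \<sigma> w v ts"
  proof (cases "length ts = 2")
    case True
    then obtain t u where ts: "ts = [t, u]" by (auto simp: numeral_2_eq_2 length_Suc_conv)
    have "deg_part 2 (star_op (phi Q \<sigma> v w)) ts = inverse (- 2 * of_real pi * \<i>) * phi Q \<sigma> v w [t, u]"
      unfolding ts deg_part_def star_op_def by simp
    then show ?thesis unfolding ts star_phi_pair phi_KM_basis_pair .
  next
    case False
    then show ?thesis using homogeneous_phi_KM_basis[of e \<sigma> w v] by (simp add: deg_part_def homogeneous_def)
  qed
qed

end

context framed_period_chart
begin

text \<open>The description in \<open>phi_KM\<close> is well defined because every adapted basis
  gives the same form, expressed through \<phi> without a basis, and because an adapted basis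
  exists.\<close>

lemma phi_KM_eq:
  assumes "has_signature_n_2 Q CARD('n)" "w \<in> U"
  shows "phi_KM Q \<sigma> v w = deg_part 2 (star_op (phi Q \<sigma> v w))"
proof -
  have all: "phi_KM_basis e \<sigma> w v = deg_part 2 (star_op (phi Q \<sigma> v w))"
    if e: "adapted_basis Q CARD('n) (cline (\<sigma> w)) e" for e
  proof -
    obtain c where "complexify (e (CARD('n) + 1)) + \<i> *s complexify (e (CARD('n) + 2)) = c *s \<sigma> w"
      using e unfolding adapted_basis_def cline_def by blast
    then interpret adapted_framed_chart Q U \<sigma> w e c "CARD('n)"
      using e assms(2) by unfold_locales (simp_all add: adapted_basis_def)
    show ?thesis using star_phi_eq_phi_KM_basis by simp
  qed
  \<comment> \<open>The basis \<open>e0\<close> witnesses the signature and need not be adapted at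
    \<open>w\<close>; the adapted \<open>e\<close> is then built from the line of
    \<sigma>(w).\<close>
  obtain e0 where "orthogonal_basis Q CARD('n) e0"
    using assms(1) by (auto simp: has_signature_n_2_def)
  then interpret orthogonal_frame Q "CARD('n)" e0
    by unfold_locales (rule Q_sym)
  obtain e where "adapted_basis Q CARD('n) (cline (\<sigma> w)) e"
    using exists_adapted_basis isotropic_negative[OF assms(2)] by (auto simp: norm_sq_def)
  with all show ?thesis
    unfolding phi_KM_def by (intro the_equality) auto
qed

end

theorem theorem3p1:
  fixes Q :: "rat ^ 'd \<Rightarrow> rat ^ 'd \<Rightarrow> rat"
    and U :: "(complex ^ 'n) set"
    and \<sigma> :: "complex ^ 'n \<Rightarrow> complex ^ 'd"
    and w :: "complex ^ 'n"
    and r :: nat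
    and vs :: "(real ^ 'd) list"
  assumes "CARD('n) \<ge> 1"
    and "CARD('d) = CARD('n) + 2"
    and "sym_bilinear Q" and "nondegenerate Q"
    and "has_signature_n_2 Q CARD('n)"
    and "r \<ge> 1" and "length vs = r"
    and "framed_chart Q U \<sigma>" and "w \<in> U"
  shows "deg_part (2 * r) (star_op (phi_tuple Q \<sigma> vs w)) = phi_KM_tuple Q \<sigma> vs w"
proof -
  interpret framed_period_chart Q U \<sigma>
    using assms by unfold_locales
  \<comment> \<open>Each factor starts in degree 2, so degree 2r of the product involves only the
    degree 2 components.\<close>
  have "deg_part (2 * length vs) (star_op (phi_tuple Q \<sigma> vs w)) =
      wedge_list (map (\<lambda>v. deg_part 2 (star_op (phi Q \<sigma> v w))) vs)"
    unfolding phi_tuple_def by (rule star_wedge_list_lowest[THEN conjunct2]) (rule phi_low_degree(1)[OF \<open>w \<in> U\<close>])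
  then show ?thesis
    unfolding phi_KM_tuple_def
    by (simp add: phi_KM_eq[OF \<open>has_signature_n_2 Q CARD('n)\<close> \<open>w \<in> U\<close>] \<open>length vs = r\<close>)
qed

end
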